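(* Let $G$ be a graph on $n$ vertices subject to edge insertions and deletions, and let $\eta = \frac{1}{2\ln n}$. There is a deterministic dynamic algorithm that maintains an orientation $\overrightarrow{G}$ of $G$ such that every directed edge $\overrightarrow{uv}$ satisfies $d^+(u) \le (1+\eta)\,d^+(v) + 2$, every vertex has out-degree $O(\rho + \log n)$ (i.e. $\Delta(\overrightarrow{G}) \in O(\rho+\log n)$), and each update (edge insertion or deletion in $G$) is processed in worst-case time $O\big((\rho+\log n)\cdot \log n\cdot \log \rho\big)$, where $\rho$ is the maximum subgraph density of $G$ at the time of the update.
   Context: The maximum subgraph density of $G=(V,E)$ is $\max_{\emptyset\ne S\subseteq V}|E(S)|/|S|$, where $E(S)$ is the set of edges with both endpoints in $S$. For an orientation, $d^+(u)$ denotes the out-degree of $u$ and $\Delta(\overrightarrow{G})$ the maximum out-degree. *)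

theory Defs
  imports Complex_Main
begin

section \<open>Graphs, orientations, subgraph density\<close>

text \<open>
  A simple graph on a vertex set is given by its set of edges, each edge being a
  two-element set of vertices. An orientation is a set of arcs.
\<close>

definition edges_within :: "'a set set \<Rightarrow> 'a set \<Rightarrow> 'a set set" where
  "edges_within E S = {e \<in> E. e \<subseteq> S}"

definition max_density :: "'a set \<Rightarrow> 'a set set \<Rightarrow> real" where
  "max_density V E =
     Max ((\<lambda>S. real (card (edges_within E S)) / real (card S)) ` {S. S \<subseteq> V \<and> S \<noteq> {}})"

definition orientation_of :: "'a set set \<Rightarrow> ('a \<times> 'a) set \<Rightarrow> bool" where
  "orientation_of E D \<longleftrightarrow> bij_betw (\<lambda>(u, v). {u, v}) D E"

definition outdeg :: "('a \<times> 'a) set \<Rightarrow> 'a \<Rightarrow> nat" where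
  "outdeg D u = card {v. (u, v) \<in> D}"

definition max_outdeg :: "'a set \<Rightarrow> ('a \<times> 'a) set \<Rightarrow> nat" where
  "max_outdeg V D = Max (outdeg D ` V)"

section \<open>A deterministic word RAM\<close>

text \<open>
  Programs are structured while-programs over unboundedly many registers (each program
  mentions finitely many) and one random access memory, both holding words of \<open>w\<close> bits.
  Arithmetic is modulo \<open>2 ^ w\<close>; every operator, literal, register access, load, store and
  branch costs one time unit. Comparisons yield 0 or 1, and a condition holds if it is nonzero.
\<close>

datatype binop = OpAdd | OpSub | OpMul | OpDiv | OpLess | OpEq

datatype expr = Lit nat | Reg nat | Load expr | Op binop expr expr

datatype com =
    Skip
  | SetReg nat expr
  | Store expr expr
  | Seq com com
  | Cond expr com com
  | While expr com

datatype state = State (regs: "nat \<Rightarrow> nat") (mem: "nat \<Rightarrow> nat")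

fun binop_val :: "nat \<Rightarrow> binop \<Rightarrow> nat \<Rightarrow> nat \<Rightarrow> nat" where
  "binop_val w OpAdd a b = (a + b) mod 2 ^ w"
| "binop_val w OpSub a b = (a + 2 ^ w - b) mod 2 ^ w"
| "binop_val w OpMul a b = (a * b) mod 2 ^ w"
| "binop_val w OpDiv a b = a div b"
| "binop_val w OpLess a b = (if a < b then 1 else 0)"
| "binop_val w OpEq a b = (if a = b then 1 else 0)"

fun expr_val :: "nat \<Rightarrow> state \<Rightarrow> expr \<Rightarrow> nat" where
  "expr_val w s (Lit k) = k mod 2 ^ w"
| "expr_val w s (Reg r) = regs s r"
| "expr_val w s (Load e) = mem s (expr_val w s e)"
| "expr_val w s (Op f e1 e2) = binop_val w f (expr_val w s e1) (expr_val w s e2)"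

fun expr_cost :: "expr \<Rightarrow> nat" where
  "expr_cost (Lit k) = 1"
| "expr_cost (Reg r) = 1"
| "expr_cost (Load e) = expr_cost e + 1"
| "expr_cost (Op f e1 e2) = expr_cost e1 + expr_cost e2 + 1"

text \<open>\<open>exec w c s t s'\<close>: started in \<open>s\<close>, the program \<open>c\<close> halts in \<open>s'\<close> after time \<open>t\<close>.\<close>

inductive exec :: "nat \<Rightarrow> com \<Rightarrow> state \<Rightarrow> nat \<Rightarrow> state \<Rightarrow> bool" for w :: nat where
  Skip: "exec w Skip s 1 s"
| SetReg: "exec w (SetReg r e) s (expr_cost e + 1)
             (State ((regs s)(r := expr_val w s e)) (mem s))"
| Store: "exec w (Store a e) s (expr_cost a + expr_cost e + 1)
             (State (regs s) ((mem s)(expr_val w s a := expr_val w s e)))"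
| Seq: "exec w c1 s t1 s1 \<Longrightarrow> exec w c2 s1 t2 s2 \<Longrightarrow> exec w (Seq c1 c2) s (t1 + t2) s2"
| CondTrue: "expr_val w s b \<noteq> 0 \<Longrightarrow> exec w c1 s t s' \<Longrightarrow>
             exec w (Cond b c1 c2) s (expr_cost b + 1 + t) s'"
| CondFalse: "expr_val w s b = 0 \<Longrightarrow> exec w c2 s t s' \<Longrightarrow>
             exec w (Cond b c1 c2) s (expr_cost b + 1 + t) s'"
| WhileFalse: "expr_val w s b = 0 \<Longrightarrow> exec w (While b c) s (expr_cost b + 1) s"
| WhileTrue: "expr_val w s b \<noteq> 0 \<Longrightarrow> exec w c s t1 s1 \<Longrightarrow> exec w (While b c) s1 t2 s2 \<Longrightarrow>
             exec w (While b c) s (expr_cost b + 1 + t1 + t2) s2"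

inductive_cases exec_SkipE: "exec w Skip s t s'"
inductive_cases exec_SetRegE: "exec w (SetReg r e) s t s'"
inductive_cases exec_StoreE: "exec w (Store a e) s t s'"
inductive_cases exec_SeqE: "exec w (Seq c1 c2) s t s'"
inductive_cases exec_CondE: "exec w (Cond b c1 c2) s t s'"
inductive_cases exec_WhileE: "exec w (While b c) s t s'"

lemma exec_deterministic:
  "exec w c s t1 s1 \<Longrightarrow> exec w c s t2 s2 \<Longrightarrow> t1 = t2 \<and> s1 = s2"
proof (induction arbitrary: t2 s2 rule: exec.induct)
  case (Skip s)
  then show ?case by (rule exec_SkipE) simp
next
  case (SetReg r e s)
  then show ?case by (rule exec_SetRegE) simp
next
  case (Store a e s)
  then show ?case by (rule exec_StoreE) simp
next
  case (Seq c1 s t1 s1 c2 t2' s2')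
  obtain ta sa tb where *: "t2 = ta + tb" "exec w c1 s ta sa" "exec w c2 sa tb s2"
    using Seq.prems by (rule exec_SeqE)
  show ?case
    using Seq.IH(1)[OF *(2)] Seq.IH(2)[of tb s2] * by simp
next
  case (CondTrue s b c1 t s' c2)
  obtain ta where *: "t2 = expr_cost b + 1 + ta" "exec w c1 s ta s2"
    using CondTrue.prems by (rule exec_CondE) (simp_all add: CondTrue.hyps)
  show ?case
    using CondTrue.IH[OF *(2)] *(1) by simp
next
  case (CondFalse s b c2 t s' c1)
  obtain ta where *: "t2 = expr_cost b + 1 + ta" "exec w c2 s ta s2"
    using CondFalse.prems by (rule exec_CondE) (simp_all add: CondFalse.hyps)
  show ?case
    using CondFalse.IH[OF *(2)] *(1) by simp
next
  case (WhileFalse s b c)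
  from WhileFalse.prems show ?case
    by (rule exec_WhileE) (simp_all add: WhileFalse.hyps)
next
  case (WhileTrue s b c t1 s1 t2' s2')
  obtain ta sa tb where *: "t2 = expr_cost b + 1 + ta + tb"
      "exec w c s ta sa" "exec w (While b c) sa tb s2"
    using WhileTrue.prems by (rule exec_WhileE) (simp_all add: WhileTrue.hyps)
  show ?case
    using WhileTrue.IH(1)[OF *(2)] WhileTrue.IH(2)[of tb s2] * by simp
qed

section \<open>Dynamic graph algorithms\<close>

datatype update = Insert nat nat | Delete nat nat

fun valid_update :: "nat \<Rightarrow> nat set set \<Rightarrow> update \<Rightarrow> bool" where
  "valid_update n E (Insert u v) \<longleftrightarrow> u < n \<and> v < n \<and> u \<noteq> v \<and> {u, v} \<notin> E"
| "valid_update n E (Delete u v) \<longleftrightarrow> u < n \<and> v < n \<and> u \<noteq> v \<and> {u, v} \<in> E"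

fun apply_update :: "nat set set \<Rightarrow> update \<Rightarrow> nat set set" where
  "apply_update E (Insert u v) = insert {u, v} E"
| "apply_update E (Delete u v) = E - {{u, v}}"

text \<open>
  A dynamic algorithm is a pair of programs \<open>(ins, del)\<close>. The machine starts with \<open>n\<close> in
  register 0 and zeros elsewhere, and with the edgeless graph on \<open>{..<n}\<close>; there is no free
  preprocessing. An update places the endpoints of the edge in registers 1 and 2 and runs the
  corresponding program; all registers and memory cells persist between updates. Every graph
  can be reached from the edgeless one by insertions.
\<close>

definition initial_state :: "nat \<Rightarrow> state" where
  "initial_state n = State ((\<lambda>_. 0)(0 := n)) (\<lambda>_. 0)"

definition load_args :: "nat \<Rightarrow> nat \<Rightarrow> state \<Rightarrow> state" where
  "load_args u v s = State ((regs s)(1 := u, 2 := v)) (mem s)"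

fun exec_update :: "nat \<Rightarrow> com \<times> com \<Rightarrow> update \<Rightarrow> state \<Rightarrow> nat \<Rightarrow> state \<Rightarrow> bool" where
  "exec_update w A (Insert u v) s t s' \<longleftrightarrow> exec w (fst A) (load_args u v s) t s'"
| "exec_update w A (Delete u v) s t s' \<longleftrightarrow> exec w (snd A) (load_args u v s) t s'"

text \<open>
  \<open>reachable w A n E s\<close>: some valid sequence of updates leads to the graph \<open>E\<close>, with the
  machine in state \<open>s\<close> after the algorithm has processed the sequence.
\<close>

inductive reachable :: "nat \<Rightarrow> com \<times> com \<Rightarrow> nat \<Rightarrow> nat set set \<Rightarrow> state \<Rightarrow> bool"
  for w :: nat and A :: "com \<times> com" and n :: nat where
  start: "reachable w A n {} (initial_state n)"
| step: "reachable w A n E s \<Longrightarrow> valid_update n E x \<Longrightarrow> exec_update w A x s t s' \<Longrightarrow>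
         reachable w A n (apply_update E x) s'"

text \<open>
  The maintained orientation is stored explicitly as out-neighbour lists: cell \<open>u < n\<close> holds
  the out-degree of \<open>u\<close>, and cells \<open>n + u * n + i\<close>, for \<open>i\<close> below that out-degree, hold the
  distinct out-neighbours of \<open>u\<close>. Distinctness is enforced by the cardinality condition.
\<close>

definition stores_orientation :: "nat \<Rightarrow> state \<Rightarrow> (nat \<times> nat) set \<Rightarrow> bool" where
  "stores_orientation n s D \<longleftrightarrow>
     D = {(u, mem s (n + u * n + i)) |u i. u < n \<and> i < mem s u} \<and>
     (\<forall>u<n. mem s u = outdeg D u)"

end

theory Submission
  imports Defs
begin

text \<open>
  With \<open>K = 2 \<lceil>log n\<rceil> + 2\<close> the algorithm keeps \<open>K d\<^sup>+(u) \<le> (K + 1) d\<^sup>+(v) + 2 K\<close> on every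
  arc \<open>uv\<close>, which suffices because \<open>K \<ge> 2 ln n\<close>. A new edge is directed away from its endpoint of
  smaller out-degree; while the vertex \<open>u\<close> whose out-degree has grown violates the condition with
  an out-neighbour \<open>v\<close>, the arc is flipped and \<open>v\<close> takes over the surplus. After a deletion the deficit
  moves in the same way to the in-neighbour of largest out-degree, which a tournament tree
  over the in-neighbours provides in time \<open>O (log n)\<close>. Out-degrees are strictly monotone along a chain, so
  a chain has at most \<open>\<Delta> + 1\<close> flips; only the out-degree of its last vertex changes in the end and
  has to be written to the trees of at most \<open>\<Delta> + 1\<close> out-neighbours. All this takes
  \<open>O (\<Delta> log n)\<close> time, and the condition on the arcs forces \<open>\<Delta> \<in> O (\<rho> + log n)\<close>.
\<close>

section \<open>Timed weakest preconditions\<close>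

definition wp :: "nat \<Rightarrow> com \<Rightarrow> (state \<Rightarrow> nat \<Rightarrow> bool) \<Rightarrow> state \<Rightarrow> nat \<Rightarrow> bool" where
  "wp w c Q s T \<longleftrightarrow> (\<exists>t s'. exec w c s t s' \<and> t \<le> T \<and> Q s' (T - t))"

lemma exec_Skip_iff: "exec w Skip s t s' \<longleftrightarrow> t = 1 \<and> s' = s"
  by (auto elim: exec_SkipE intro: exec.Skip[simplified])

lemma exec_SetReg_iff:
  "exec w (SetReg r e) s t s' \<longleftrightarrow>
     t = expr_cost e + 1 \<and> s' = State ((regs s)(r := expr_val w s e)) (mem s)"
  by (auto elim: exec_SetRegE intro: exec.SetReg[simplified])

lemma exec_Store_iff:
  "exec w (Store a e) s t s' \<longleftrightarrow> t = expr_cost a + expr_cost e + 1 \<and>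
     s' = State (regs s) ((mem s)(expr_val w s a := expr_val w s e))"
  by (auto elim: exec_StoreE intro: exec.Store[simplified])

lemma exec_Cond_iff:
  "exec w (Cond b c1 c2) s t s' \<longleftrightarrow>
     (\<exists>ta. t = expr_cost b + 1 + ta \<and> exec w (if expr_val w s b \<noteq> 0 then c1 else c2) s ta s')"
  by (auto elim!: exec_CondE intro: exec.CondTrue[simplified] exec.CondFalse[simplified])

lemma exec_Seq_iff:
  "exec w (Seq c1 c2) s t s' \<longleftrightarrow>
     (\<exists>ta sa tb. t = ta + tb \<and> exec w c1 s ta sa \<and> exec w c2 sa tb s')"
  by (auto elim!: exec_SeqE intro: exec.Seq)

lemma exec_While_iff:
  "exec w (While b c) s t s' \<longleftrightarrow>
     (if expr_val w s b \<noteq> 0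
      then \<exists>ta. t = expr_cost b + 1 + ta \<and> exec w (Seq c (While b c)) s ta s'
      else t = expr_cost b + 1 \<and> s' = s)"
proof (cases "expr_val w s b = 0")
  case True
  then show ?thesis
    by (auto elim: exec_WhileE intro: exec.WhileFalse[simplified])
next
  case False
  show ?thesis
  proof
    assume "exec w (While b c) s t s'"
    then obtain t1 s1 t2 where "t = expr_cost b + 1 + t1 + t2" "exec w c s t1 s1"
      "exec w (While b c) s1 t2 s'"
      using False by (auto elim: exec_WhileE)
    then show "if expr_val w s b \<noteq> 0
      then \<exists>ta. t = expr_cost b + 1 + ta \<and> exec w (Seq c (While b c)) s ta s'
      else t = expr_cost b + 1 \<and> s' = s"
      using False by (auto simp: exec_Seq_iff)
  next
    assume "if expr_val w s b \<noteq> 0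
      then \<exists>ta. t = expr_cost b + 1 + ta \<and> exec w (Seq c (While b c)) s ta s'
      else t = expr_cost b + 1 \<and> s' = s"
    then obtain t1 s1 t2 where "t = expr_cost b + 1 + t1 + t2" "exec w c s t1 s1"
      "exec w (While b c) s1 t2 s'"
      using False by (auto simp: exec_Seq_iff)
    then show "exec w (While b c) s t s'"
      using exec.WhileTrue[OF False] by blast
  qed
qed

lemma wp_Skip [simp]: "wp w Skip Q s T \<longleftrightarrow> 1 \<le> T \<and> Q s (T - 1)"
  by (auto simp: wp_def exec_Skip_iff)

lemma wp_SetReg [simp]:
  "wp w (SetReg r e) Q s T \<longleftrightarrow> expr_cost e + 1 \<le> T \<and>
     Q (State ((regs s)(r := expr_val w s e)) (mem s)) (T - (expr_cost e + 1))"
  by (auto simp: wp_def exec_SetReg_iff)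

lemma wp_Store [simp]:
  "wp w (Store a e) Q s T \<longleftrightarrow> expr_cost a + expr_cost e + 1 \<le> T \<and>
     Q (State (regs s) ((mem s)(expr_val w s a := expr_val w s e)))
       (T - (expr_cost a + expr_cost e + 1))"
  by (auto simp: wp_def exec_Store_iff)

lemma wp_Cond [simp]:
  "wp w (Cond b c1 c2) Q s T \<longleftrightarrow> expr_cost b + 1 \<le> T \<and>
     (if expr_val w s b \<noteq> 0 then wp w c1 Q s (T - (expr_cost b + 1))
      else wp w c2 Q s (T - (expr_cost b + 1)))" (is "?L \<longleftrightarrow> ?R")
proof
  assume ?L
  then obtain t s' where "exec w (if expr_val w s b \<noteq> 0 then c1 else c2) s t s'"
      "expr_cost b + 1 + t \<le> T" "Q s' (T - (expr_cost b + 1 + t))"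
    unfolding wp_def exec_Cond_iff by blast
  then show ?R
    unfolding wp_def by (auto intro!: exI[of _ t] exI[of _ s'])
next
  assume ?R
  then have T: "expr_cost b + 1 \<le> T"
    and w: "wp w (if expr_val w s b \<noteq> 0 then c1 else c2) Q s (T - (expr_cost b + 1))"
    by (auto split: if_splits)
  from w obtain t s' where "exec w (if expr_val w s b \<noteq> 0 then c1 else c2) s t s'"
      "t \<le> T - (expr_cost b + 1)" "Q s' (T - (expr_cost b + 1) - t)"
    unfolding wp_def by blast
  with T show ?L
    unfolding wp_def exec_Cond_iff
    by (intro exI[of _ "expr_cost b + 1 + t"] exI[of _ s']) auto
qed

text \<open>The postcondition also receives the unspent budget, so time is threaded like state:
  sequencing is nesting of \<open>wp\<close>, and simplification computes running time and effect
  together.\<close>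

lemma wp_Seq [simp]: "wp w (Seq c1 c2) Q s T \<longleftrightarrow> wp w c1 (wp w c2 Q) s T" (is "?L \<longleftrightarrow> ?R")
proof
  assume ?L
  then obtain ta sa tb s' where "exec w c1 s ta sa" "exec w c2 sa tb s'" "ta + tb \<le> T" 
      "Q s' (T - (ta + tb))"
    unfolding wp_def exec_Seq_iff by blast
  then show ?R
    unfolding wp_def by (intro exI[of _ ta] exI[of _ sa] conjI exI[of _ tb] exI[of _ s']) auto
next
  assume ?R
  then obtain ta sa tb s' where "exec w c1 s ta sa" "exec w c2 sa tb s'" "ta \<le> T" "tb \<le> T - ta"
      "Q s' (T - ta - tb)"
    unfolding wp_def by blast
  then show ?L
    unfolding wp_def exec_Seq_iff by (intro exI[of _ "ta + tb"] exI[of _ s']) auto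
qed

text \<open>Not a simp rule, since it would unfold without end; each loop gets a folded instance
  that is applied explicitly.\<close>

lemma wp_While:
  "wp w (While b c) Q s T \<longleftrightarrow> expr_cost b + 1 \<le> T \<and>
     (if expr_val w s b \<noteq> 0 then wp w c (wp w (While b c) Q) s (T - (expr_cost b + 1))
      else Q s (T - (expr_cost b + 1)))"
proof -
  have "wp w (While b c) Q s T \<longleftrightarrow>
      wp w (Cond b (Seq c (While b c)) Skip) Q s T" if "expr_val w s b \<noteq> 0"
    using that by (simp only: wp_def exec_Cond_iff exec_While_iff[of w b c s]) auto
  moreover have "wp w (While b c) Q s T \<longleftrightarrow> expr_cost b + 1 \<le> T \<and> Q s (T - (expr_cost b + 1))"
    if "expr_val w s b = 0"
    using that by (simp only: wp_def exec_While_iff[of w b c s]) auto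
  ultimately show ?thesis
    by (cases "expr_val w s b = 0") simp_all
qed

section \<open>Orientations and density\<close>

text \<open>For positive \<open>n\<close> this is the ceiling of the binary logarithm, in the form
  in which repeated doubling finds it.\<close>

definition lg :: "nat \<Rightarrow> nat" where
  "lg n = (LEAST j. n \<le> 2 ^ j)"

lemma le_two_power_lg: "n \<le> 2 ^ lg n"
  unfolding lg_def by (rule LeastI[of _ n]) (simp add: less_imp_le)

lemma lg_le: "n \<le> 2 ^ j \<Longrightarrow> lg n \<le> j"
  unfolding lg_def by (rule Least_le)

section \<open>Effect of single arcs on out-degrees and orientations\<close>

lemma outdeg_insert:
  fixes n :: nat
  assumes "D \<subseteq> {..<n} \<times> {..<n}" "(x, y) \<notin> D"
  shows "outdeg (insert (x, y) D) = (outdeg D)(x := Suc (outdeg D x))"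
proof
  fix u
  have "finite {v. (u, v) \<in> D}"
    by (rule finite_subset[of _ "{..<n}"]) (use assms in auto)
  moreover have "{v. (u, v) \<in> insert (x, y) D} =
      (if u = x then insert y {v. (u, v) \<in> D} else {v. (u, v) \<in> D})"
    by auto
  ultimately show "outdeg (insert (x, y) D) u = ((outdeg D)(x := Suc (outdeg D x))) u"
    using assms(2) by (auto simp: outdeg_def)
qed

lemma outdeg_remove:
  fixes n :: nat
  assumes "D \<subseteq> {..<n} \<times> {..<n}" "(x, y) \<in> D"
  shows "outdeg (D - {(x, y)}) = (outdeg D)(x := outdeg D x - 1)"
proof
  fix u
  have "finite {v. (u, v) \<in> D}"
    by (rule finite_subset[of _ "{..<n}"]) (use assms in auto)
  moreover have "{v. (u, v) \<in> D - {(x, y)}} =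
      (if u = x then {v. (u, v) \<in> D} - {y} else {v. (u, v) \<in> D})"
    by auto
  ultimately show "outdeg (D - {(x, y)}) u = ((outdeg D)(x := outdeg D x - 1)) u"
    using assms(2) by (simp add: outdeg_def)
qed

lemma outdeg_pos:
  fixes n :: nat
  assumes "D \<subseteq> {..<n} \<times> {..<n}" "(x, y) \<in> D"
  shows "outdeg D x \<noteq> 0"
proof -
  have "finite {v. (x, v) \<in> D}"
    by (rule finite_subset[of _ "{..<n}"]) (use assms in auto)
  then show ?thesis
    using assms(2) by (auto simp: outdeg_def)
qed

text \<open>The out-neighbours of \<open>x\<close> avoid \<open>y\<close>. This guarantees a free
  cell in the row of \<open>x\<close> when the arc \<open>(x, y)\<close> is added.\<close>

lemma outdeg_less:
  fixes n :: nat
  assumes "D \<subseteq> {..<n} \<times> {..<n}" "(x, y) \<notin> D" "y < n"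
  shows "outdeg D x < n"
proof -
  have "{v. (x, v) \<in> D} \<subseteq> {..<n} - {y}"
    using assms by auto
  then have "outdeg D x \<le> card ({..<n} - {y})"
    unfolding outdeg_def by (intro card_mono) auto
  with assms(3) show ?thesis
    by simp
qed

lemma outdeg_le:
  fixes n :: nat
  assumes "D \<subseteq> {..<n} \<times> {..<n}"
  shows "outdeg D x \<le> n"
proof -
  have "outdeg D x \<le> card {..<n}"
    unfolding outdeg_def by (intro card_mono) (use assms in auto)
  then show ?thesis by simp
qed

lemma orientation_of_insert:
  assumes "orientation_of E D" "{u, v} \<notin> E"
  shows "orientation_of (insert {u, v} E) (insert (u, v) D)"
proof -
  have "(u, v) \<notin> D"
    using assms unfolding orientation_of_def bij_betw_def by force
  moreover have "{u, v} \<notin> (\<lambda>(u, v). {u, v}) ` D"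
    using assms unfolding orientation_of_def bij_betw_def by simp
  ultimately show ?thesis
    using assms unfolding orientation_of_def bij_betw_def
    by simp
qed

lemma orientation_of_remove:
  assumes "orientation_of E D" "(u, v) \<in> D"
  shows "orientation_of (E - {{u, v}}) (D - {(u, v)})"
proof -
  let ?f = "\<lambda>(u, v). {u, v}"
  have inj: "inj_on ?f D" and E: "E = ?f ` D"
    using assms unfolding orientation_of_def bij_betw_def by simp_all
  have "?f ` (D - {(u, v)}) = ?f ` D - ?f ` {(u, v)}"
    by (rule inj_on_image_set_diff[OF inj]) (use assms in auto)
  then show ?thesis
    using inj unfolding orientation_of_def bij_betw_def E
    by (auto intro: inj_on_subset)
qed

lemma orientation_of_edge: "orientation_of E D \<Longrightarrow> (u, v) \<in> D \<Longrightarrow> {u, v} \<in> E"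
  unfolding orientation_of_def bij_betw_def by force

lemma orientation_of_edge_cases:
  assumes "orientation_of E D" "{u, v} \<in> E"
  shows "(u, v) \<in> D \<or> (v, u) \<in> D"
  using assms unfolding orientation_of_def bij_betw_def
  by (auto simp: doubleton_eq_iff)

text \<open>Both arcs are mapped to the same edge and the edge map is injective. Hence the reversed
  arc that a flip adds is new.\<close>

lemma orientation_of_antisym:
  assumes "orientation_of E D" "(u, v) \<in> D" "(v, u) \<in> D"
  shows "u = v"
  using assms unfolding orientation_of_def bij_betw_def inj_on_def
  by (fastforce simp: insert_commute)

lemma orientation_of_flip:
  assumes "orientation_of E D" "(u, v) \<in> D"
  shows "orientation_of E (insert (v, u) (D - {(u, v)}))"
proof -
  have "orientation_of (insert {v, u} (E - {{u, v}})) (insert (v, u) (D - {(u, v)}))"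
    by (rule orientation_of_insert[OF orientation_of_remove[OF assms]]) (simp add: insert_commute)
  moreover have "insert {v, u} (E - {{u, v}}) = E"
    using orientation_of_edge[OF assms] by (auto simp: insert_commute)
  ultimately show ?thesis by simp
qed

section \<open>Maximum density and the bound it puts on out-degrees\<close>

lemma max_density_ge:
  fixes n :: nat
  assumes "S \<subseteq> {..<n}" "S \<noteq> {}"
  shows "real (card (edges_within E S)) \<le> max_density {..<n} E * real (card S)"
proof -
  have "finite S"
    using assms(1) finite_subset by blast
  then have pos: "0 < real (card S)"
    using assms(2) by (simp add: card_gt_0_iff)
  have "real (card (edges_within E S)) / real (card S) \<le> max_density {..<n} E"
    unfolding max_density_def by (rule Max_ge) (use assms in auto)
  then show ?thesis
    using pos by (simp add: pos_divide_le_eq)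
qed

lemma max_density_nonneg: "0 < (n :: nat) \<Longrightarrow> 0 \<le> max_density {..<n} E"
  using order_trans[OF of_nat_0_le_iff max_density_ge[of "{0}" n E]] by simp

text \<open>A nonempty set has at least one vertex, so \<open>\<delta>\<close> additional edges
  raise its density by at most \<open>\<delta>\<close>.\<close>

lemma max_density_mono:
  fixes n :: nat
  assumes "0 < n" "finite E'"
    and le: "\<And>S. S \<subseteq> {..<n} \<Longrightarrow> S \<noteq> {} \<Longrightarrow>
      real (card (edges_within E S)) \<le> real (card (edges_within E' S)) + \<delta>" "0 \<le> \<delta>"
  shows "max_density {..<n} E \<le> max_density {..<n} E' + \<delta>"
  unfolding max_density_def[of _ E]
proof (rule Max.boundedI)
  show "finite ((\<lambda>S. real (card (edges_within E S)) / real (card S)) ` {S. S \<subseteq> {..<n} \<and> S \<noteq> {}})"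
    by (rule finite_imageI, rule finite_subset[of _ "Pow {..<n}"]) auto
  show "(\<lambda>S. real (card (edges_within E S)) / real (card S)) ` {S. S \<subseteq> {..<n} \<and> S \<noteq> {}} \<noteq> {}"
    using assms(1) by auto
next
  fix a
  assume "a \<in> (\<lambda>S. real (card (edges_within E S)) / real (card S)) ` {S. S \<subseteq> {..<n} \<and> S \<noteq> {}}"
  then obtain S where S: "S \<subseteq> {..<n}" "S \<noteq> {}"
    and a: "a = real (card (edges_within E S)) / real (card S)"
    by auto
  have "finite S"
    using S(1) finite_subset by blast
  then have pos: "1 \<le> real (card S)"
    using S(2) by (simp add: Suc_le_eq card_gt_0_iff)
  have "real (card (edges_within E S)) \<le> max_density {..<n} E' * real (card S) + \<delta>"
    using le(1)[OF S] max_density_ge[OF S, of E'] by linarith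
  also have "\<dots> \<le> (max_density {..<n} E' + \<delta>) * real (card S)"
    using mult_left_mono[OF pos le(2)] by (simp add: algebra_simps)
  finally show "a \<le> max_density {..<n} E' + \<delta>"
    unfolding a using pos by (simp add: pos_divide_le_eq)
qed

text \<open>
  The level sets of the out-degree at the thresholds \<open>\<Delta> - i (\<Delta> / K + 2)\<close> contain all
  out-neighbours of their predecessors, so they double in size while the threshold exceeds
  twice the density.
\<close>

lemma outdeg_le_max_density:
  fixes n :: nat
  assumes D: "D \<subseteq> {..<n} \<times> {..<n}" and or: "orientation_of E D"
    and ok: "\<And>x y. (x, y) \<in> D \<Longrightarrow> K * outdeg D x \<le> (K + 1) * outdeg D y + 2 * K"
    and K: "K = 2 * L + 2" and n: "n \<le> 2 ^ L" and "u < n"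
  shows "real (outdeg D u) \<le> 4 * max_density {..<n} E + 4 * real L"
proof -
  define \<Delta> where "\<Delta> = Max (outdeg D ` {..<n})"
  define \<rho> where "\<rho> = max_density {..<n} E"
  \<comment> \<open>The tail exceeds the head by at most 2 plus the K-th part of the degree of the
    head; bounding the latter by \<open>\<Delta> / K\<close> makes the loss the same at every
    level.\<close>
  define s where "s i = real \<Delta> - real i * (real \<Delta> / real K + 2)" for i
  define S where "S i = {x. x < n \<and> s i \<le> real (outdeg D x)}" for i
  have le_\<Delta>: "outdeg D x \<le> \<Delta>" if "x < n" for x
    unfolding \<Delta>_def using that by (intro Max_ge) auto
  have finE: "finite E"
  proof -
    have "finite D" by (rule finite_subset[OF D]) simp
    with or show ?thesis unfolding orientation_of_def bij_betw_def by auto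
  qed
  have Kpos: "0 < real K" using K by simp
  have s_Suc: "s (Suc i) = s i - (real \<Delta> / real K + 2)" for i
    unfolding s_def by (simp add: distrib_right)
  have sub: "S i \<subseteq> S (Suc i)" for i
  proof -
    have "s (Suc i) \<le> s i"
      unfolding s_Suc using divide_nonneg_nonneg[of "real \<Delta>" "real K"] by linarith
    then show ?thesis unfolding S_def by auto
  qed
  have nbr: "y \<in> S (Suc i)" if xy: "(x, y) \<in> D" and x: "x \<in> S i" for x y i
  proof -
    have "y < n" using D xy by auto
    have "real (K * outdeg D x) \<le> real ((K + 1) * outdeg D y + 2 * K)"
      using ok[OF xy] of_nat_le_iff by blast
    then have "real K * real (outdeg D x) \<le> real K * (real (outdeg D y) + 2) + real (outdeg D y)"
      by (simp add: algebra_simps)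
    also have "\<dots> \<le> real K * (real (outdeg D y) + 2) + real \<Delta>"
      using le_\<Delta>[OF \<open>y < n\<close>] by simp
    also have "\<dots> = real K * (real (outdeg D y) + 2 + real \<Delta> / real K)"
      using Kpos by (simp add: algebra_simps)
    finally have "real (outdeg D x) \<le> real (outdeg D y) + 2 + real \<Delta> / real K"
      using Kpos by (simp only: mult_le_cancel_left_pos)
    moreover have "s i \<le> real (outdeg D x)" using x unfolding S_def by simp
    ultimately have "s (Suc i) \<le> real (outdeg D y)"
      unfolding s_Suc by simp
    with \<open>y < n\<close> show ?thesis unfolding S_def by simp
  qed
  have fin: "finite (S i)" for i unfolding S_def by simp
  have grow: "s i * real (card (S i)) \<le> \<rho> * real (card (S (Suc i)))"
    if "S (Suc i) \<noteq> {}" for i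
  proof -
    let ?A = "SIGMA x:S i. {y. (x, y) \<in> D}"
    have "s i * real (card (S i)) = (\<Sum>x\<in>S i. s i)" by simp
    also have "\<dots> \<le> (\<Sum>x\<in>S i. real (outdeg D x))"
      by (rule sum_mono) (simp add: S_def)
    also have "\<dots> = real (card ?A)"
    proof -
      have "finite {y. (x, y) \<in> D}" for x
        by (rule finite_subset[of _ "{..<n}"]) (use D in auto)
      then show ?thesis by (simp add: fin card_SigmaI outdeg_def)
    qed
    \<comment> \<open>Arcs leaving \<open>S i\<close> end in \<open>S (Suc i)\<close>, which also
      contains \<open>S i\<close>, and distinct arcs are distinct edges.\<close>
    also have "card ?A \<le> card (edges_within E (S (Suc i)))"
    proof (rule card_inj_on_le)
      show "inj_on (\<lambda>(u, v). {u, v}) ?A"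
        using or unfolding orientation_of_def bij_betw_def by (auto intro: inj_on_subset)
      show "(\<lambda>(u, v). {u, v}) ` ?A \<subseteq> edges_within E (S (Suc i))"
      proof (clarsimp simp: edges_within_def)
        fix x y assume x: "x \<in> S i" and xy: "(x, y) \<in> D"
        show "{x, y} \<in> E \<and> x \<in> S (Suc i) \<and> y \<in> S (Suc i)"
          using orientation_of_edge[OF or xy] nbr[OF xy x] sub[of i] x by auto
      qed
      show "finite (edges_within E (S (Suc i)))"
        using finE by (simp add: edges_within_def)
    qed
    also have "real (card (edges_within E (S (Suc i)))) \<le> \<rho> * real (card (S (Suc i)))"
      unfolding \<rho>_def by (rule max_density_ge) (use that in \<open>auto simp: S_def\<close>)
    finally show ?thesis by simp
  qed
  have \<rho>: "0 \<le> \<rho>" unfolding \<rho>_def using \<open>u < n\<close> by (intro max_density_nonneg) simp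
  have "real \<Delta> \<le> 4 * \<rho> + 4 * real L"
  proof (rule ccontr)
    assume "\<not> ?thesis"
    then have big: "4 * \<rho> + 4 * real L < real \<Delta>" by simp
    \<comment> \<open>As \<open>L / K\<close> is at most 1/2, \<open>L\<close> levels lower the
      threshold by at most \<open>\<Delta> / 2 + 2 * L\<close>. This fixes both the choice of
      \<open>K\<close> and the constants 4.\<close>
    have s: "2 * \<rho> < s i" if "i \<le> L" for i
    proof -
      have "real i * (real \<Delta> / real K + 2) \<le> real L * (real \<Delta> / real K + 2)"
        using that by (intro mult_right_mono) auto
      also have "\<dots> = real \<Delta> * (real L / real K) + 2 * real L" by (simp add: algebra_simps)
      also have "real \<Delta> * (real L / real K) \<le> real \<Delta> * (1 / 2)"
        by (intro mult_left_mono) (use K in \<open>auto simp: field_simps\<close>)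
      finally show ?thesis unfolding s_def using big by linarith
    qed
    have "2 ^ i \<le> card (S i)" if "i \<le> Suc L" for i
      using that
    proof (induction i)
      case 0
      have "\<Delta> \<in> outdeg D ` {..<n}"
        unfolding \<Delta>_def using \<open>u < n\<close> by (intro Max_in) auto
      then have "S 0 \<noteq> {}" unfolding S_def s_def by auto
      then show ?case using fin[of 0] by (simp add: Suc_le_eq card_gt_0_iff)
    next
      case (Suc i)
      then have ih: "2 ^ i \<le> card (S i)" and i: "i \<le> L" by simp_all
      then have pos: "0 < card (S i)" by (auto intro: gr0I)
      then have "S (Suc i) \<noteq> {}" using sub[of i] by auto
      have "2 * \<rho> * real (card (S i)) < s i * real (card (S i))"
        using s[OF i] pos by simp
      also have "\<dots> \<le> \<rho> * real (card (S (Suc i)))" by (rule grow) fact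
      finally have "\<rho> * real (2 * card (S i)) < \<rho> * real (card (S (Suc i)))"
        by (simp add: algebra_simps)
      then have "real (2 * card (S i)) < real (card (S (Suc i)))"
        using \<rho> by (rule mult_left_less_imp_less)
      then have "2 * card (S i) < card (S (Suc i))" by (simp only: of_nat_less_iff)
      with ih show ?case by simp
    qed
    \<comment> \<open>Starting from one vertex, \<open>Suc L\<close> doublings give at least
      \<open>2 * n\<close> vertices, more than there are.\<close>
    from this[of "Suc L"] have "2 * n \<le> card (S (Suc L))" using n by simp
    also have "\<dots> \<le> card {..<n}" by (intro card_mono) (auto simp: S_def)
    finally show False using \<open>u < n\<close> by simp
  qed
  moreover have "outdeg D u \<le> \<Delta>" using le_\<Delta>[OF \<open>u < n\<close>] .
  ultimately show ?thesis unfolding \<rho>_def by linarith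
qed

section \<open>Addresses and stored lists\<close>

text \<open>All numbers computed are at most quadratic in \<open>n\<close>: addresses lie below 4
  n^2 + n, and the sides of the arc test are at most 9 n^2. With this word length no addition or
  multiplication wraps.\<close>

definition big :: "nat \<Rightarrow> nat \<Rightarrow> bool" where
  "big n w \<longleftrightarrow> 2 \<le> n \<and> 100 * (n * n) \<le> 2 ^ w"

lemma big_mod:
  assumes "big n w" "k < 100 * (n * n)"
  shows "k mod 2 ^ w = k"
  using assms unfolding big_def by simp

lemma big_mod_linear:
  assumes "big n w" "k \<le> 100 * n"
  shows "k mod 2 ^ w = k"
proof (rule big_mod[OF assms(1)])
  have "100 * n < 100 * (n * n)"
    using assms(1) unfolding big_def by simp
  with assms(2) show "k < 100 * (n * n)" by (rule le_less_trans)
qed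

lemma sub_mod:
  assumes "b \<le> a" "a mod M = (a :: nat)" "0 < M"
  shows "(a + M - b) mod M = a - b"
proof -
  have "a < M" using mod_less_divisor[OF assms(3), of a] assms(2) by simp
  have eq: "a + M - b = (a - b) + M" using assms(1) by simp
  show ?thesis unfolding eq using \<open>a < M\<close> by simp
qed

lemma row_less: "u < a \<Longrightarrow> i < n \<Longrightarrow> u * n + i < a * (n :: nat)"
proof -
  assume "u < a" "i < n"
  then have "u * n + i < Suc u * n" by simp
  also have "\<dots> \<le> a * n" using \<open>u < a\<close> by (intro mult_le_mono1) simp
  finally show ?thesis .
qed

lemma row_eq_iff: "i < n \<Longrightarrow> i' < n \<Longrightarrow> u * n + i = u' * n + i' \<longleftrightarrow> u = u' \<and> i = (i' :: nat)"
proof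
  assume *: "i < n" "i' < n" "u * n + i = u' * n + i'"
  have "(a * n + j) div n = a" "(a * n + j) mod n = j" if "j < n" for a j
    using that by simp_all
  from this[OF *(1), of u] this[OF *(2), of u'] *(3) show "u = u' \<and> i = i'" by simp
qed simp

text \<open>
  Besides the out-neighbour lists in the cells \<open>adL n u i\<close>, the cell \<open>adP n u v\<close> holds the position
  of \<open>v\<close> in the list of \<open>u\<close> (stale unless \<open>uv\<close> is an arc), so that an arc is removed in constant time.
  The cells \<open>adT n v i\<close> form a tournament tree with root \<open>i = 1\<close> and leaves \<open>i = n + u\<close>; a leaf
  holds 0 unless \<open>uv\<close> is an arc, which the initial memory satisfies for free.
\<close>

definition adL :: "nat \<Rightarrow> nat \<Rightarrow> nat \<Rightarrow> nat" where
  "adL n u i = n + u * n + i"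

definition adP :: "nat \<Rightarrow> nat \<Rightarrow> nat \<Rightarrow> nat" where
  "adP n u v = n + (n + u) * n + v"

definition adT :: "nat \<Rightarrow> nat \<Rightarrow> nat \<Rightarrow> nat" where
  "adT n v i = n + 2 * (n + v) * n + i"

lemma adL_bounds: "u < n \<Longrightarrow> i < n \<Longrightarrow> n \<le> adL n u i \<and> adL n u i < n + n * n"
  using row_less[of u n i n] by (simp add: adL_def)

lemma adP_bounds: "u < n \<Longrightarrow> i < n \<Longrightarrow> n + n * n \<le> adP n u i \<and> adP n u i < n + 2 * n * n"
  using row_less[of "n + u" "2 * n" i n] by (simp add: adP_def algebra_simps)

lemma adT_bounds: "n + 2 * n * n \<le> adT n v i"
  by (simp add: adT_def algebra_simps)

lemma adL_eq_iff [simp]: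
  "i < n \<Longrightarrow> i' < n \<Longrightarrow> adL n u i = adL n u' i' \<longleftrightarrow> u = u' \<and> i = i'"
  using row_eq_iff[of i n i' u u'] by (simp add: adL_def)

lemma adP_eq_iff [simp]:
  "i < n \<Longrightarrow> i' < n \<Longrightarrow> adP n u i = adP n u' i' \<longleftrightarrow> u = u' \<and> i = i'"
  using row_eq_iff[of i n i' "n + u" "n + u'"] by (simp add: adP_def)

lemma adT_eq_iff [simp]:
  "i < 2 * n \<Longrightarrow> i' < 2 * n \<Longrightarrow> adT n u i = adT n u' i' \<longleftrightarrow> u = u' \<and> i = i'"
  using row_eq_iff[of i "2 * n" i' "n + u" "n + u'"] by (simp add: adT_def algebra_simps)

text \<open>Degrees, lists, positions and trees occupy consecutive disjoint ranges, separated at n,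
  n + n^2 and n + 2 n^2. As simp rules, in both directions, these facts resolve reads after
  writes.\<close>

lemma ad_neq [simp]:
  "u < n \<Longrightarrow> i < n \<Longrightarrow> a < n \<Longrightarrow> adL n u i \<noteq> a"
  "u < n \<Longrightarrow> i < n \<Longrightarrow> a < n \<Longrightarrow> a \<noteq> adL n u i"
  "u < n \<Longrightarrow> i < n \<Longrightarrow> a < n \<Longrightarrow> adP n u i \<noteq> a"
  "u < n \<Longrightarrow> i < n \<Longrightarrow> a < n \<Longrightarrow> a \<noteq> adP n u i"
  "a < n \<Longrightarrow> adT n v j \<noteq> a"
  "a < n \<Longrightarrow> a \<noteq> adT n v j"
  "u < n \<Longrightarrow> i < n \<Longrightarrow> u' < n \<Longrightarrow> i' < n \<Longrightarrow> adL n u i \<noteq> adP n u' i'"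
  "u < n \<Longrightarrow> i < n \<Longrightarrow> u' < n \<Longrightarrow> i' < n \<Longrightarrow> adP n u' i' \<noteq> adL n u i"
  "u < n \<Longrightarrow> i < n \<Longrightarrow> adL n u i \<noteq> adT n v j"
  "u < n \<Longrightarrow> i < n \<Longrightarrow> adT n v j \<noteq> adL n u i"
  "u < n \<Longrightarrow> i < n \<Longrightarrow> adP n u i \<noteq> adT n v j"
  "u < n \<Longrightarrow> i < n \<Longrightarrow> adT n v j \<noteq> adP n u i"
  using adL_bounds[of u n i] adP_bounds[of u n i] adP_bounds[of u' n i'] adT_bounds[of n v j]
  by auto

definition eL :: "expr \<Rightarrow> expr \<Rightarrow> expr" where
  "eL a b = Op OpAdd (Reg 0) (Op OpAdd (Op OpMul a (Reg 0)) b)"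

definition eP :: "expr \<Rightarrow> expr \<Rightarrow> expr" where
  "eP a b = eL (Op OpAdd (Reg 0) a) b"

definition eT :: "expr \<Rightarrow> expr \<Rightarrow> expr" where
  "eT a b = eL (Op OpMul (Lit 2) (Op OpAdd (Reg 0) a)) b"

lemma expr_cost_ad [simp]:
  "expr_cost (eL a b) = expr_cost a + expr_cost b + 5"
  "expr_cost (eP a b) = expr_cost a + expr_cost b + 7"
  "expr_cost (eT a b) = expr_cost a + expr_cost b + 9"
  by (simp_all add: eL_def eP_def eT_def)

text \<open>Positions and trees reuse the list address with a shifted row: n + u for positions, 2 (n
  + v) for trees, whose rows have length 2 n. Hence the range of rows up to 4 n and of columns below
  2 n.\<close>

lemma expr_val_eL_aux:
  assumes "big n w" "regs s 0 = n" "expr_val w s a \<le> 4 * n" "expr_val w s b < 2 * n"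
  shows "expr_val w s (eL a b) = n + expr_val w s a * n + expr_val w s b"
proof -
  have "expr_val w s a * n \<le> 4 * (n * n)"
    using mult_le_mono1[OF assms(3), of n] by simp
  moreover have "n * 2 \<le> n * n"
    using assms(1) unfolding big_def by simp
  moreover have "0 < n * n" using assms(1) unfolding big_def by simp
  ultimately have "n + (expr_val w s a * n + expr_val w s b) < 100 * (n * n)"
    using assms(4) by linarith
  then have "k mod 2 ^ w = k" if "k \<le> n + (expr_val w s a * n + expr_val w s b)" for k
    using that by (intro big_mod[OF assms(1)]) (rule le_less_trans)
  then show ?thesis
    using assms(2) by (simp add: eL_def)
qed

lemma expr_val_eL [simp]:
  assumes "big (regs s 0) w" "expr_val w s a < regs s 0" "expr_val w s b < regs s 0"
  shows "expr_val w s (eL a b) = adL (regs s 0) (expr_val w s a) (expr_val w s b)"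
  using assms by (subst expr_val_eL_aux[OF assms(1) refl]) (simp_all add: adL_def)

lemma expr_val_eP [simp]:
  assumes "big (regs s 0) w" "expr_val w s a < regs s 0" "expr_val w s b < regs s 0"
  shows "expr_val w s (eP a b) = adP (regs s 0) (expr_val w s a) (expr_val w s b)"
proof -
  have "expr_val w s (Op OpAdd (Reg 0) a) = regs s 0 + expr_val w s a"
    using assms by (simp add: big_mod_linear)
  then show ?thesis
    using assms unfolding eP_def
    by (subst expr_val_eL_aux[OF assms(1) refl]) (simp_all del: expr_val.simps add: adP_def)
qed

lemma expr_val_eT [simp]:
  assumes "big (regs s 0) w" "expr_val w s a < regs s 0" "expr_val w s b < 2 * regs s 0"
  shows "expr_val w s (eT a b) = adT (regs s 0) (expr_val w s a) (expr_val w s b)"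
proof -
  have two: "2 mod 2 ^ w = (2 :: nat)"
    using assms(1) by (intro big_mod_linear) (auto simp: big_def)
  have "expr_val w s (Op OpMul (Lit 2) (Op OpAdd (Reg 0) a)) = 2 * (regs s 0 + expr_val w s a)"
    using assms by (simp add: big_mod_linear two)
  then show ?thesis
    using assms unfolding eT_def
    by (subst expr_val_eL_aux[OF assms(1) refl]) (simp_all del: expr_val.simps add: adT_def)
qed

section \<open>Representation of out-lists and trees in memory\<close>

definition inner :: "nat \<Rightarrow> nat \<Rightarrow> (nat \<Rightarrow> nat) \<Rightarrow> nat \<Rightarrow> bool" where
  "inner n v m j \<longleftrightarrow> m (adT n v j) = max (m (adT n v (2 * j))) (m (adT n v (2 * j + 1)))"

text \<open>The heap numbering works for every \<open>n\<close>, not just for powers of two: nodes 1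
  to n - 1 are inner, n to 2 n - 1 are leaves, and the leaves may lie on two neighbouring
  levels.\<close>

definition tree_rep :: "nat \<Rightarrow> nat \<Rightarrow> (nat \<Rightarrow> nat) \<Rightarrow> (nat \<Rightarrow> nat) \<Rightarrow> bool" where
  "tree_rep n v f m \<longleftrightarrow> (\<forall>u<n. m (adT n v (n + u)) = f u) \<and> (\<forall>j. 1 \<le> j \<and> j < n \<longrightarrow> inner n v m j)"

text \<open>List entries and positions are inverse to each other on the arcs. This makes the entries
  of a list distinct, so that its length is the out-degree.\<close>

definition list_rep :: "nat \<Rightarrow> (nat \<times> nat) set \<Rightarrow> (nat \<Rightarrow> nat) \<Rightarrow> bool" where
  "list_rep n D m \<longleftrightarrow> D \<subseteq> {..<n} \<times> {..<n} \<and>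
     (\<forall>u<n. m u \<le> n \<and> (\<forall>i<m u. m (adL n u i) < n \<and> (u, m (adL n u i)) \<in> D \<and>
        m (adP n u (m (adL n u i))) = i)) \<and>
     (\<forall>u v. (u, v) \<in> D \<longrightarrow> m (adP n u v) < m u \<and> m (adL n u (m (adP n u v))) = v)"

definition same_off_tree :: "nat \<Rightarrow> nat \<Rightarrow> (nat \<Rightarrow> nat) \<Rightarrow> (nat \<Rightarrow> nat) \<Rightarrow> bool" where
  "same_off_tree n v m m' \<longleftrightarrow> (\<forall>a. (\<forall>i<2 * n. a \<noteq> adT n v i) \<longrightarrow> m' a = m a)"

lemma tree_rep_same:
  assumes "same_off_tree n v m m'" "tree_rep n v' f m" "v \<noteq> v'"
  shows "tree_rep n v' f m'"
proof -
  have "m' (adT n v' i) = m (adT n v' i)" if "i < 2 * n" for i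
    using assms(1,3) that unfolding same_off_tree_def by auto
  then show ?thesis
    using assms(2) unfolding tree_rep_def inner_def by simp
qed

lemma list_rep_same:
  assumes "same_off_tree n v m m'" "list_rep n D m"
  shows "list_rep n D m'"
proof -
  have D: "D \<subseteq> {..<n} \<times> {..<n}" using assms(2) unfolding list_rep_def by simp
  have d: "m' u = m u" if "u < n" for u
    using assms(1) that unfolding same_off_tree_def by simp
  have l: "m' (adL n u i) = m (adL n u i)" if "u < n" "i < n" for u i
    using assms(1) that unfolding same_off_tree_def by simp
  have p: "m' (adP n u i) = m (adP n u i)" if "u < n" "i < n" for u i
    using assms(1) that unfolding same_off_tree_def by simp
  have le: "m u \<le> n" if "u < n" for u
    using assms(2) that unfolding list_rep_def by simp
  show ?thesis
    unfolding list_rep_def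
  proof (intro conjI allI impI)
    fix u assume u: "u < n"
    show "m' u \<le> n" using le d u by simp
    fix i assume i: "i < m' u"
    then have i': "i < m u" "i < n" using u d le[OF u] by auto
    then have *: "m (adL n u i) < n" "(u, m (adL n u i)) \<in> D" "m (adP n u (m (adL n u i))) = i"
      using assms(2) u unfolding list_rep_def by auto
    show "m' (adL n u i) < n" "(u, m' (adL n u i)) \<in> D" "m' (adP n u (m' (adL n u i))) = i"
      using * l[OF u i'(2)] p[OF u *(1)] by simp_all
  next
    fix u v assume uv: "(u, v) \<in> D"
    then have "u < n" "v < n" using D by auto
    moreover have *: "m (adP n u v) < m u" "m (adL n u (m (adP n u v))) = v"
      using assms(2) uv unfolding list_rep_def by auto
    ultimately show "m' (adP n u v) < m' u" "m' (adL n u (m' (adP n u v))) = v"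
      using d p l le[of u] by auto
  qed (use D in auto)
qed

lemma list_rep_outdeg:
  assumes "list_rep n D m" "u < n"
  shows "outdeg D u = m u" "{v. (u, v) \<in> D} = (\<lambda>i. m (adL n u i)) ` {..<m u}"
proof -
  show eq: "{v. (u, v) \<in> D} = (\<lambda>i. m (adL n u i)) ` {..<m u}"
    using assms unfolding list_rep_def by (auto simp: image_iff) (metis lessThan_iff)
  have "inj_on (\<lambda>i. m (adL n u i)) {..<m u}"
    using assms unfolding list_rep_def by (intro inj_onI) (metis lessThan_iff)
  then show "outdeg D u = m u"
    unfolding outdeg_def eq by (simp add: card_image)
qed

lemma list_rep_empty: "list_rep n {} (\<lambda>_. 0)"
  unfolding list_rep_def by simp

lemma list_rep_insert:
  assumes rep: "list_rep n D m" and x: "x < n" and y: "y < n" and xy: "(x, y) \<notin> D"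
  shows "list_rep n (insert (x, y) D)
    (m(adL n x (m x) := y, adP n x y := m x, x := Suc (m x)))" (is "list_rep _ _ ?m")
proof -
  have D: "D \<subseteq> {..<n} \<times> {..<n}" using rep unfolding list_rep_def by simp
  \<comment> \<open>Otherwise the new entry would fall into the row of the next vertex.\<close>
  have less: "m x < n"
    using outdeg_less[OF D xy y] list_rep_outdeg(1)[OF rep x] by simp
  have le: "m u \<le> n" if "u < n" for u
    using rep that unfolding list_rep_def by simp
  have L: "m (adL n u i) < n" "(u, m (adL n u i)) \<in> D" "m (adP n u (m (adL n u i))) = i"
    if "u < n" "i < m u" for u i
    using rep that unfolding list_rep_def by auto
  have P: "m (adP n u v) < m u" "m (adL n u (m (adP n u v))) = v" if "(u, v) \<in> D" for u v
    using rep that unfolding list_rep_def by auto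
  have lm: "?m (adL n u i) = (if u = x \<and> i = m x then y else m (adL n u i))"
    if "u < n" "i < n" for u i using that less x y by simp
  have pm: "?m (adP n u v) = (if u = x \<and> v = y then m x else m (adP n u v))"
    if "u < n" "v < n" for u v using that less x y by simp
  have dm: "?m u = (if u = x then Suc (m x) else m u)" if "u < n" for u
    using that less x y by simp
  show ?thesis
    unfolding list_rep_def
  proof (intro conjI allI impI)
    show "insert (x, y) D \<subseteq> {..<n} \<times> {..<n}" using D x y by simp
  next
    fix u assume u: "u < n"
    show "?m u \<le> n" unfolding dm[OF u] using le[OF u] less by simp
    fix i assume i: "i < ?m u"
    then have in': "i < n" using dm[OF u] le[OF u] less by (auto split: if_splits)
    have "u = x \<and> i = m x \<or> i < m u" using i unfolding dm[OF u] by (auto split: if_splits)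
    then show "?m (adL n u i) < n" "(u, ?m (adL n u i)) \<in> insert (x, y) D"
      "?m (adP n u (?m (adL n u i))) = i"
      unfolding lm[OF u in'] using L[OF u] xy y u by (auto simp: pm simp del: fun_upd_apply)
  next
    fix u v assume uv: "(u, v) \<in> insert (x, y) D"
    then have u: "u < n" and v: "v < n" using D x y by auto
    show "?m (adP n u v) < ?m u" "?m (adL n u (?m (adP n u v))) = v"
      using uv P[of u v] xy less le[OF u] u
      unfolding pm[OF u v] dm[OF u] by (auto simp: lm simp del: fun_upd_apply)
  qed
qed

text \<open>The last entry \<open>l\<close> moves to the position \<open>p\<close> that becomes
  free. If \<open>y\<close> itself is the last entry, then \<open>l = y\<close> and the last two
  writes store what was there before; the position of \<open>y\<close> becomes stale.\<close>

lemma list_rep_remove: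
  assumes rep: "list_rep n D m" and xy: "(x, y) \<in> D"
  defines "d \<equiv> m x - 1" and "p \<equiv> m (adP n x y)"
  defines "l \<equiv> m (adL n x d)"
  shows "list_rep n (D - {(x, y)})
    (m(x := d, adL n x p := l, adP n x l := p))" (is "list_rep _ _ ?m")
proof -
  have D: "D \<subseteq> {..<n} \<times> {..<n}" using rep unfolding list_rep_def by simp
  with xy have x: "x < n" and y: "y < n" by auto
  have le: "m u \<le> n" if "u < n" for u
    using rep that unfolding list_rep_def by simp
  have L: "m (adL n u i) < n" "(u, m (adL n u i)) \<in> D" "m (adP n u (m (adL n u i))) = i"
    if "u < n" "i < m u" for u i
    using rep that unfolding list_rep_def by auto
  have P: "m (adP n u v) < m u" "m (adL n u (m (adP n u v))) = v" if "(u, v) \<in> D" for u v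
    using rep that unfolding list_rep_def by auto
  have p: "p < m x" "m (adL n x p) = y" using P[OF xy] unfolding p_def by auto
  then have d: "m x = Suc d" unfolding d_def by simp
  have ln: "l < n" and lD: "(x, l) \<in> D" and lp: "m (adP n x l) = d"
    using L[OF x, of d] d unfolding l_def by auto
  have dn: "d < n" "p < n" using le[OF x] d p by auto
  have lm: "?m (adL n u i) = (if u = x \<and> i = p then l else m (adL n u i))"
    if "u < n" "i < n" for u i using that dn x y ln by simp
  have pm: "?m (adP n u v) = (if u = x \<and> v = l then p else m (adP n u v))"
    if "u < n" "v < n" for u v using that dn x y ln by simp
  have dm: "?m u = (if u = x then d else m u)" if "u < n" for u
    using that dn x y ln by simp
  show ?thesis
    unfolding list_rep_def
  proof (intro conjI allI impI)
    show "D - {(x, y)} \<subseteq> {..<n} \<times> {..<n}" using D by auto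
  next
    fix u assume u: "u < n"
    show "?m u \<le> n" unfolding dm[OF u] using le[OF u] dn by simp
    fix i assume i: "i < ?m u"
    then have im: "i < m u" using dm[OF u] d by (auto split: if_splits)
    then have in': "i < n" using le[OF u] by simp
    have ne: "(x, l) \<noteq> (x, y)" if "u = x" "i = p"
    proof
      assume "(x, l) = (x, y)"
      then have "d = p" using lp unfolding p_def by simp
      with i that dm[OF u] show False by simp
    qed
    have ne2: "m (adL n x i) \<noteq> y" if "u = x" "i \<noteq> p"
      using L(3)[OF u im] that unfolding p_def by auto
    have ne3: "m (adL n x i) \<noteq> l" if "u = x"
      using L(3)[OF u im] that lp i dm[OF u] by auto
    show "?m (adL n u i) < n" "(u, ?m (adL n u i)) \<in> D - {(x, y)}"
      "?m (adP n u (?m (adL n u i))) = i"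
      unfolding lm[OF u in'] using L[OF u im] ln lD ne ne2 ne3 u
      by (auto simp: pm simp del: fun_upd_apply)
  next
    fix u v assume uv: "(u, v) \<in> D - {(x, y)}"
    then have u: "u < n" and v: "v < n" and uvD: "(u, v) \<in> D" using D by auto
    have Pn: "m (adP n u v) < n" using P(1)[OF uvD] le[OF u] by simp
    have ne: "p \<noteq> d" if "u = x" "v = l"
      using that uv p(2) unfolding l_def by auto
    have ne2: "m (adP n x v) \<noteq> d" if "u = x" "v \<noteq> l"
      using P(2)[OF uvD] that unfolding l_def by auto
    have ne3: "m (adP n x v) \<noteq> p" if "u = x"
      using P(2)[OF uvD] that uv p(2) by auto
    have lt: "p < d" if "u = x" "v = l" using ne[OF that] p(1) d by simp
    have lt2: "m (adP n x v) < d" if "u = x" "v \<noteq> l" using ne2[OF that] P(1)[OF uvD] d that by simp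
    show "?m (adP n u v) < ?m u" "?m (adL n u (?m (adP n u v))) = v"
      unfolding pm[OF u v] dm[OF u] using P[OF uvD] lt lt2 ne3 dn Pn u
      by (auto simp: lm simp del: fun_upd_apply)
  qed
qed

section \<open>Tournament trees of in-neighbours\<close>

abbreviation seq_com :: "com \<Rightarrow> com \<Rightarrow> com" (infixr ";;" 55) where
  "c ;; d \<equiv> Seq c d"

definition same_regs :: "nat set \<Rightarrow> state \<Rightarrow> state \<Rightarrow> bool" where
  "same_regs R s s' \<longleftrightarrow> (\<forall>r. r \<notin> R \<longrightarrow> regs s' r = regs s r)"

lemma big_lit:
  assumes "big n w"
  shows "0 < w" "2 mod 2 ^ w = (2 :: nat)"
proof -
  have "1 * 1 \<le> n * n" using assms unfolding big_def by (intro mult_le_mono) auto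
  then have "1 < (2 :: nat) ^ w" using assms unfolding big_def by linarith
  then show "0 < w" by (cases w) auto
  show "2 mod 2 ^ w = (2 :: nat)"
    using assms by (intro big_mod_linear) (auto simp: big_def)
qed

text \<open>
  Register 3 holds \<open>K\<close>, registers 10 and 11 the tail and the head of the arc to be added or removed
  (10 alone: the current vertex of a chain), register 7 the key for the leaf of this arc, register 15
  the flag of the main loops; 4, 8, 9, 12, 13, 14 and 16 are scratch.
\<close>

definition climb_body :: com where
  "climb_body =
     (SetReg 8 (Op OpDiv (Reg 8) (Lit 2)) ;;
      SetReg 9 (Op OpAdd (Reg 8) (Reg 8)) ;;
      Cond (Op OpLess (Load (eT (Reg 11) (Reg 9))) (Load (eT (Reg 11) (Op OpAdd (Reg 9) (Lit 1)))))
        (Store (eT (Reg 11) (Reg 8)) (Load (eT (Reg 11) (Op OpAdd (Reg 9) (Lit 1)))))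
        (Store (eT (Reg 11) (Reg 8)) (Load (eT (Reg 11) (Reg 9)))))"

definition climb :: com where
  "climb = While (Op OpLess (Lit 1) (Reg 8)) climb_body"

lemmas climb_unfold = wp_While[of _ "Op OpLess (Lit 1) (Reg 8)" climb_body, folded climb_def]

declare One_nat_def [simp del]

definition set_leaf :: com where
  "set_leaf =
     SetReg 8 (Op OpAdd (Reg 0) (Reg 10)) ;;
     Store (eT (Reg 11) (Reg 8)) (Reg 7) ;;
     climb"

text \<open>Only the parent of the current node may be wrong. Repairing it moves the possible defect
  one level up, until the root is reached, whose parent index 0 is no node. The exponent
  \<open>j\<close> bounds the number of levels above \<open>i\<close>.\<close>

lemma wp_climb:
  assumes big: "big n w" and v: "v < n"
  shows "regs s 0 = n \<Longrightarrow> regs s 11 = v \<Longrightarrow> regs s 8 = i \<Longrightarrow> 1 \<le> i \<Longrightarrow> i < 2 * n \<Longrightarrow> i < 2 ^ Suc j \<Longrightarrow>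
    (\<And>k. 1 \<le> k \<Longrightarrow> k < n \<Longrightarrow> k \<noteq> i div 2 \<Longrightarrow> inner n v (mem s) k) \<Longrightarrow> 120 * Suc j \<le> T \<Longrightarrow>
    (\<And>s' T'. same_regs {8, 9} s s' \<Longrightarrow> (\<And>k. 1 \<le> k \<Longrightarrow> k < n \<Longrightarrow> inner n v (mem s') k) \<Longrightarrow>
       (\<And>a. (\<forall>k<n. a \<noteq> adT n v k) \<Longrightarrow> mem s' a = mem s a) \<Longrightarrow> T \<le> T' + 120 * Suc j \<Longrightarrow> Q s' T') \<Longrightarrow>
    wp w climb Q s T"
proof (induction j arbitrary: s i T)
  case (0 s i T)
  note lits = big_lit[OF big]
  have i: "i = 1" using 0(4,6) by simp
  show ?case
    using 0 i lits
    by (subst climb_unfold) (auto simp: same_regs_def)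
next
  case (Suc j s i T)
  note mod = big_mod_linear[OF big]
  note lits = big_lit[OF big]
  show ?case
  proof (cases "i = 1")
    case True
    then show ?thesis
      using Suc.prems lits
      by (subst climb_unfold) (auto simp: same_regs_def)
  next
    case False
    define h where "h = i div 2"
    have h: "1 \<le> h" "h < n" "h < 2 ^ Suc j" "h < 2 * n"
      using False Suc.prems(4,5,6) unfolding h_def by auto
    define m where "m = (mem s)(adT n v h := max (mem s (adT n v (2 * h))) (mem s (adT n v (2 * h + 1))))"
    define s1 where "s1 = State ((regs s)(8 := h, 9 := 2 * h)) m"
    have inner1: "inner n v m k" if k: "1 \<le> k" "k < n" "k \<noteq> h div 2" for k
    proof (cases "k = h")
      case True
      then show ?thesis using h unfolding inner_def m_def by simp
    next
      case False
      then have "inner n v (mem s) k"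
        using Suc.prems(7) k h_def by simp
      moreover have "2 * k \<noteq> h" "2 * k + 1 \<noteq> h" using k(3) by auto
      ultimately show ?thesis
        using False k h unfolding inner_def m_def by simp
    qed
    have hh: "(h + h) mod 2 ^ w = 2 * h" "(2 * h + 1) mod 2 ^ w = 2 * h + 1"
      using mod[of "h + h"] mod[of "2 * h + 1"] h by simp_all
    \<comment> \<open>The time of a round depends on the branch taken and is left to the simplifier;
      the claim therefore covers every amount \<open>t\<close> up to a generous bound.\<close>
    have wp1: "wp w climb Q s1 (T - t)" if "t \<le> 120" for t
    proof (rule Suc.IH[of s1 h])
      show "regs s1 0 = n" "regs s1 11 = v" "regs s1 8 = h"
        using Suc.prems by (simp_all add: s1_def)
      show "inner n v (mem s1) k" if "1 \<le> k" "k < n" "k \<noteq> h div 2" for k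
        using inner1[OF that] by (simp add: s1_def)
      show "120 * Suc j \<le> T - t" using Suc.prems(8) that by simp
    next
      fix s' T'
      assume *: "same_regs {8, 9} s1 s'" "\<And>k. 1 \<le> k \<Longrightarrow> k < n \<Longrightarrow> inner n v (mem s') k"
        "\<And>a. (\<forall>k<n. a \<noteq> adT n v k) \<Longrightarrow> mem s' a = mem s1 a" "T - t \<le> T' + 120 * Suc j"
      show "Q s' T'"
      proof (rule Suc.prems(9))
        show "same_regs {8, 9} s s'" using *(1) by (simp add: same_regs_def s1_def)
        show "mem s' a = mem s a" if "\<forall>k<n. a \<noteq> adT n v k" for a
          using *(3)[OF that] that h by (simp add: s1_def m_def)
        show "T \<le> T' + 120 * Suc (Suc j)" using *(4) that by simp
      qed (use *(2) in simp)
    qed (use h in auto)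
    have g: "1 < i" using False Suc.prems(4) by simp
    have m_eq: "mem s (adT n v (2 * h)) < mem s (adT n v (2 * h + 1)) \<Longrightarrow>
        (mem s)(adT n v h := mem s (adT n v (2 * h + 1))) = m"
      "\<not> mem s (adT n v (2 * h)) < mem s (adT n v (2 * h + 1)) \<Longrightarrow>
        (mem s)(adT n v h := mem s (adT n v (2 * h))) = m"
      by (simp_all add: m_def max_def)
    show ?thesis
      using Suc.prems(1,2,3,8) big v h g
      by (subst climb_unfold)
        (simp add: climb_body_def lits hh h_def[symmetric] wp1[unfolded s1_def] m_eq, arith)
  qed
qed

lemma wp_set_leaf:
  assumes big: "big n w" and s: "regs s 0 = n" "regs s 11 = v" "regs s 10 = u"
    and v: "v < n" and u: "u < n"
    and tree: "tree_rep n v f (mem s)" and T: "180 * Suc (lg n) \<le> T"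
    and Q: "\<And>s' T'. same_regs {8, 9} s s' \<Longrightarrow> tree_rep n v (f(u := regs s 7)) (mem s') \<Longrightarrow>
      same_off_tree n v (mem s) (mem s') \<Longrightarrow> T \<le> T' + 180 * Suc (lg n) \<Longrightarrow> Q s' T'"
  shows "wp w set_leaf Q s T"
proof -
  define m where "m = (mem s)(adT n v (n + u) := regs s 7)"
  define s1 where "s1 = State ((regs s)(8 := n + u)) m"
  have wp1: "wp w climb Q s1 (T - t)" if "t \<le> 60" for t
  proof (rule wp_climb[OF big v, of s1 "n + u" "lg n"])
    show "regs s1 0 = n" "regs s1 11 = v" "regs s1 8 = n + u" "1 \<le> n + u" "n + u < 2 * n"
      using s u by (simp_all add: s1_def)
    show "n + u < 2 ^ Suc (lg n)"
      using u le_two_power_lg[of n] by simp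
    show "120 * Suc (lg n) \<le> T - t" using T that by simp
    show "inner n v (mem s1) k" if k: "1 \<le> k" "k < n" "k \<noteq> (n + u) div 2" for k
    proof -
      have "2 * k \<noteq> n + u" "2 * k + 1 \<noteq> n + u" using k(3) by auto
      then show ?thesis
        using tree k u unfolding tree_rep_def by (auto simp: s1_def m_def inner_def)
    qed
  next
    fix s' T'
    assume *: "same_regs {8, 9} s1 s'" "\<And>k. 1 \<le> k \<Longrightarrow> k < n \<Longrightarrow> inner n v (mem s') k"
      "\<And>a. (\<forall>k<n. a \<noteq> adT n v k) \<Longrightarrow> mem s' a = mem s1 a" "T - t \<le> T' + 120 * Suc (lg n)"
    show "Q s' T'"
    proof (rule Q)
      show "same_regs {8, 9} s s'" using *(1) by (simp add: same_regs_def s1_def)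
      have "mem s' (adT n v (n + x)) = (f(u := regs s 7)) x" if "x < n" for x
        using that u tree by (simp add: *(3) s1_def m_def tree_rep_def)
      then show "tree_rep n v (f(u := regs s 7)) (mem s')"
        using *(2) by (simp add: tree_rep_def)
      show "same_off_tree n v (mem s) (mem s')"
        using u by (auto simp: same_off_tree_def *(3) s1_def m_def)
      show "T \<le> T' + 180 * Suc (lg n)" using *(4) that by simp
    qed
  qed
  have "(n + u) mod 2 ^ w = n + u" using u by (intro big_mod_linear[OF big]) simp
  then show ?thesis
    using s u v T big wp1 by (simp add: set_leaf_def s1_def m_def, arith?)
qed

text \<open>
  A chain of flips changes the out-degree of its current vertex only, so the trees keep the
  degrees \<open>key\<close> from before the update until the chain ends.
\<close>

definition rep :: "nat \<Rightarrow> (nat \<times> nat) set \<Rightarrow> (nat \<Rightarrow> nat) \<Rightarrow> (nat \<Rightarrow> nat) \<Rightarrow> bool" where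
  "rep n D key m \<longleftrightarrow> list_rep n D m \<and>
     (\<forall>v<n. tree_rep n v (\<lambda>x. if (x, v) \<in> D then key x else 0) m)"

lemma rep_subset: "rep n D key m \<Longrightarrow> D \<subseteq> {..<n} \<times> {..<n}"
  by (simp add: rep_def list_rep_def)

lemma rep_outdeg: "rep n D key m \<Longrightarrow> u < n \<Longrightarrow> m u = outdeg D u"
  using list_rep_outdeg(1)[of n D m u] by (simp add: rep_def)

section \<open>Adding and removing one arc\<close>

lemma tree_rep_same_lists:
  assumes "tree_rep n v f m"
    "\<And>i. i < 2 * n \<Longrightarrow> m' (adT n v i) = m (adT n v i)"
  shows "tree_rep n v f m'"
  using assms unfolding tree_rep_def inner_def by simp

definition add_arc :: com where
  "add_arc =
     Store (eL (Reg 10) (Load (Reg 10))) (Reg 11) ;;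
     Store (eP (Reg 10) (Reg 11)) (Load (Reg 10)) ;;
     Store (Reg 10) (Op OpAdd (Load (Reg 10)) (Lit 1)) ;;
     set_leaf"

text \<open>Decrementing first turns the stored degree into the index of the last entry. The key 0
  in register 7 resets the leaf to the value of a non-arc.\<close>

definition remove_arc :: com where
  "remove_arc =
     Store (Reg 10) (Op OpSub (Load (Reg 10)) (Lit 1)) ;;
     SetReg 12 (Load (eL (Reg 10) (Load (Reg 10)))) ;;
     SetReg 13 (Load (eP (Reg 10) (Reg 11))) ;;
     Store (eL (Reg 10) (Reg 13)) (Reg 12) ;;
     Store (eP (Reg 10) (Reg 12)) (Reg 13) ;;
     SetReg 7 (Lit 0) ;;
     set_leaf"

lemma wp_add_arc:
  assumes big: "big n w" and s: "regs s 0 = n" "regs s 10 = x" "regs s 11 = y" "regs s 7 = key x"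
    and x: "x < n" and y: "y < n" and xy: "(x, y) \<notin> D"
    and rep: "rep n D key (mem s)" and T: "250 * Suc (lg n) \<le> T"
    and Q: "\<And>s' T'. same_regs {8, 9} s s' \<Longrightarrow> rep n (insert (x, y) D) key (mem s') \<Longrightarrow>
      T \<le> T' + 250 * Suc (lg n) \<Longrightarrow> Q s' T'"
  shows "wp w add_arc Q s T"
proof -
  define d where "d = mem s x"
  define m where "m = (mem s)(adL n x d := y, adP n x y := d, x := Suc d)"
  define s1 where "s1 = State (regs s) m"
  have lr: "list_rep n D (mem s)" using rep by (simp add: rep_def)
  have less: "d < n"
    using outdeg_less[OF rep_subset[OF rep] xy y] rep_outdeg[OF rep x] by (simp add: d_def)
  have tr: "tree_rep n v (\<lambda>z. if (z, v) \<in> D then key z else 0) m" if "v < n" for v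
    using rep that x y less
    by - (rule tree_rep_same_lists[where m = "mem s"], simp_all add: rep_def m_def)
  have wp1: "wp w set_leaf Q s1 (T - t)" if "t \<le> 60" for t
  proof (rule wp_set_leaf[OF big, of s1 y x])
    show "tree_rep n y (\<lambda>z. if (z, y) \<in> D then key z else 0) (mem s1)"
      using tr[OF y] by (simp add: s1_def)
    show "180 * Suc (lg n) \<le> T - t" using T that by simp
  next
    fix s' T'
    assume *: "same_regs {8, 9} s1 s'"
      "tree_rep n y ((\<lambda>z. if (z, y) \<in> D then key z else 0)(x := regs s1 7)) (mem s')"
      "same_off_tree n y (mem s1) (mem s')" "T - t \<le> T' + 180 * Suc (lg n)"
    show "Q s' T'"
    proof (rule Q)
      show "same_regs {8, 9} s s'" using *(1) by (simp add: same_regs_def s1_def)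
      show "T \<le> T' + 250 * Suc (lg n)" using *(4) that by simp
      have "list_rep n (insert (x, y) D) m"
        unfolding m_def d_def by (rule list_rep_insert[OF lr x y xy])
      then have "list_rep n (insert (x, y) D) (mem s')"
        using list_rep_same[OF *(3)] by (simp add: s1_def)
      moreover have "tree_rep n v (\<lambda>z. if (z, v) \<in> insert (x, y) D then key z else 0) (mem s')"
        if v: "v < n" for v
      proof (cases "v = y")
        case True
        have "(\<lambda>z. if (z, y) \<in> insert (x, y) D then key z else 0) =
            (\<lambda>z. if (z, y) \<in> D then key z else 0)(x := regs s1 7)"
          using s(4) by (auto simp: s1_def)
        then show ?thesis using *(2) True by simp
      next
        case False
        then have "(\<lambda>z. if (z, v) \<in> insert (x, y) D then key z else 0) =
            (\<lambda>z. if (z, v) \<in> D then key z else 0)"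
          by auto
        then show ?thesis
          using tree_rep_same[OF *(3), of v] tr[OF v] False by (simp add: s1_def)
      qed
      ultimately show "rep n (insert (x, y) D) key (mem s')" by (simp add: rep_def)
    qed
  qed (use s x y in \<open>simp_all add: s1_def\<close>)
  have "(d + 1) mod 2 ^ w = Suc d"
    using less by (subst big_mod_linear[OF big]) simp_all
  then show ?thesis
    using s x y T big wp1 less big_lit[OF big]
    by (simp add: add_arc_def s1_def m_def d_def[symmetric], arith?)
qed

lemma wp_remove_arc:
  assumes big: "big n w" and s: "regs s 0 = n" "regs s 10 = x" "regs s 11 = y"
    and xy: "(x, y) \<in> D"
    and rep: "rep n D key (mem s)" and T: "280 * Suc (lg n) \<le> T"
    and Q: "\<And>s' T'. same_regs {7, 8, 9, 12, 13} s s' \<Longrightarrow> rep n (D - {(x, y)}) key (mem s') \<Longrightarrow>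
      T \<le> T' + 280 * Suc (lg n) \<Longrightarrow> Q s' T'"
  shows "wp w remove_arc Q s T"
proof -
  define d where "d = mem s x - 1"
  define p where "p = mem s (adP n x y)"
  define l where "l = mem s (adL n x d)"
  define m where "m = (mem s)(x := d, adL n x p := l, adP n x l := p)"
  define s1 where "s1 = State ((regs s)(12 := l, 13 := p, 7 := 0)) m"
  have lr: "list_rep n D (mem s)" using rep by (simp add: rep_def)
  have x: "x < n" and y: "y < n" using rep_subset[OF rep] xy by auto
  have le: "mem s x \<le> n" using lr x unfolding list_rep_def by simp
  have p: "p < mem s x" using lr xy unfolding list_rep_def p_def by simp
  then have d: "mem s x = Suc d" by (simp add: d_def)
  have less: "d < n" "p < n" "l < n"
    using lr x le p d unfolding list_rep_def l_def by auto
  have tr: "tree_rep n v (\<lambda>z. if (z, v) \<in> D then key z else 0) m" if "v < n" for v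
    using rep that x y less
    by - (rule tree_rep_same_lists[where m = "mem s"], simp_all add: rep_def m_def)
  have wp1: "wp w set_leaf Q s1 (T - t)" if "t \<le> 90" for t
  proof (rule wp_set_leaf[OF big, of s1 y x])
    show "tree_rep n y (\<lambda>z. if (z, y) \<in> D then key z else 0) (mem s1)"
      using tr[OF y] by (simp add: s1_def)
    show "180 * Suc (lg n) \<le> T - t" using T that by simp
  next
    fix s' T'
    assume *: "same_regs {8, 9} s1 s'"
      "tree_rep n y ((\<lambda>z. if (z, y) \<in> D then key z else 0)(x := regs s1 7)) (mem s')"
      "same_off_tree n y (mem s1) (mem s')" "T - t \<le> T' + 180 * Suc (lg n)"
    show "Q s' T'"
    proof (rule Q)
      show "same_regs {7, 8, 9, 12, 13} s s'" using *(1) by (simp add: same_regs_def s1_def)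
      show "T \<le> T' + 280 * Suc (lg n)" using *(4) that by simp
      have "list_rep n (D - {(x, y)}) m"
        unfolding m_def l_def p_def d_def by (rule list_rep_remove[OF lr xy])
      then have "list_rep n (D - {(x, y)}) (mem s')"
        using list_rep_same[OF *(3)] by (simp add: s1_def)
      moreover have "tree_rep n v (\<lambda>z. if (z, v) \<in> D - {(x, y)} then key z else 0) (mem s')"
        if v: "v < n" for v
      proof (cases "v = y")
        case True
        have "(\<lambda>z. if (z, y) \<in> D - {(x, y)} then key z else 0) =
            (\<lambda>z. if (z, y) \<in> D then key z else 0)(x := regs s1 7)"
          by (auto simp: s1_def)
        then show ?thesis using *(2) True by simp
      next
        case False
        then have "(\<lambda>z. if (z, v) \<in> D - {(x, y)} then key z else 0) =
            (\<lambda>z. if (z, v) \<in> D then key z else 0)"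
          by auto
        then show ?thesis
          using tree_rep_same[OF *(3), of v] tr[OF v] False by (simp add: s1_def)
      qed
      ultimately show "rep n (D - {(x, y)}) key (mem s')" by (simp add: rep_def)
    qed
  qed (use s x y in \<open>simp_all add: s1_def\<close>)
  have sub: "(Suc d + 2 ^ w - 1) mod 2 ^ w = d"
    using sub_mod[of 1 "Suc d" "2 ^ w"] big_mod_linear[OF big, of "Suc d"] less by simp
  have lp: "((mem s)(x := d)) (adL n x d) = l" "((mem s)(x := d)) (adP n x y) = p"
    using x y less by (simp_all add: l_def p_def)
  show ?thesis
    using s x y T big wp1 less big_lit[OF big] sub lp
    by (simp add: remove_arc_def s1_def m_def d, arith?)
qed

section \<open>Computation of the slack parameter \<open>K\<close>\<close>

lemma lg_le_self: "lg n \<le> n"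
  by (intro lg_le) (simp add: less_imp_le)

definition double_loop :: com where
  "double_loop = While (Op OpLess (Reg 4) (Reg 0))
     (SetReg 4 (Op OpAdd (Reg 4) (Reg 4)) ;; SetReg 3 (Op OpAdd (Reg 3) (Lit 2)))"

text \<open>\<open>K\<close> is recomputed at every update: there is no preprocessing phase, and
  O(log n) doublings fit into the budget of an update.\<close>

definition compute_slack :: com where
  "compute_slack = SetReg 4 (Lit 1) ;; SetReg 3 (Lit 2) ;; double_loop"

lemmas double_loop_unfold =
  wp_While[of _ "Op OpLess (Reg 4) (Reg 0)"
    "SetReg 4 (Op OpAdd (Reg 4) (Reg 4)) ;; SetReg 3 (Op OpAdd (Reg 3) (Lit 2))",
    folded double_loop_def]

lemma wp_double_loop:
  assumes big: "big n w"
  shows "regs s 0 = n \<Longrightarrow> j \<le> lg n \<Longrightarrow> regs s 4 = 2 ^ j \<Longrightarrow> regs s 3 = 2 * Suc j \<Longrightarrow>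
    12 * Suc (lg n - j) \<le> T \<Longrightarrow>
    (\<And>s' T'. same_regs {3, 4} s s' \<Longrightarrow> mem s' = mem s \<Longrightarrow> regs s' 3 = 2 * Suc (lg n) \<Longrightarrow>
       T \<le> T' + 12 * Suc (lg n - j) \<Longrightarrow> Q s' T') \<Longrightarrow>
    wp w double_loop Q s T"
proof (induction "lg n - j" arbitrary: j s T rule: less_induct)
  case less
  show ?case
  proof (cases "2 ^ j < n")
    case False
    then have "lg n \<le> j" by (intro lg_le) simp
    with less.prems(2) have "j = lg n" by simp
    then show ?thesis
      using less.prems False by (subst double_loop_unfold) (simp add: same_regs_def)
  next
    case True
    have "j < lg n"
    proof (rule ccontr)
      assume "\<not> j < lg n"
      then have "(2 :: nat) ^ lg n \<le> 2 ^ j" by (intro power_increasing) auto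
      with True le_two_power_lg[of n] show False by linarith
    qed
    define s1 where "s1 = State ((regs s)(4 := 2 ^ Suc j, 3 := 2 * Suc (Suc j))) (mem s)"
    have wp1: "wp w double_loop Q s1 (T - 12)"
    proof (rule less.hyps[of "Suc j"])
      show "12 * Suc (lg n - Suc j) \<le> T - 12"
        using less.prems(5) \<open>j < lg n\<close> by simp
    next
      fix s' T'
      assume *: "same_regs {3, 4} s1 s'" "mem s' = mem s1" "regs s' 3 = 2 * Suc (lg n)"
        "T - 12 \<le> T' + 12 * Suc (lg n - Suc j)"
      show "Q s' T'"
      proof (rule less.prems(6))
        show "T \<le> T' + 12 * Suc (lg n - j)" using *(4) \<open>j < lg n\<close> by simp
      qed (use * in \<open>simp_all add: same_regs_def s1_def\<close>)
    qed (use less.prems \<open>j < lg n\<close> in \<open>simp_all add: s1_def\<close>)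
    have "(2 ^ j + 2 ^ j) mod 2 ^ w = (2 :: nat) ^ Suc j"
      using True by (subst big_mod_linear[OF big]) simp_all
    moreover have "(2 * Suc j + 2) mod 2 ^ w = 2 * Suc (Suc j)"
    proof -
      have "2 \<le> n" using big by (simp add: big_def)
      then have "2 * Suc j + 2 \<le> 100 * n" using \<open>j < lg n\<close> lg_le_self[of n] by presburger
      then show ?thesis by (subst big_mod_linear[OF big]) simp_all
    qed
    moreover have "24 \<le> T" using less.prems(5) \<open>j < lg n\<close> by (simp add: Suc_diff_Suc[symmetric])
    ultimately show ?thesis
      using less.prems(1,3,4) True wp1 big_lit[OF big]
      by (subst double_loop_unfold) (simp add: s1_def, arith)
  qed
qed

lemma wp_compute_slack:
  assumes big: "big n w" and s: "regs s 0 = n" and T: "20 * Suc (lg n) \<le> T"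
    and Q: "\<And>s' T'. same_regs {3, 4} s s' \<Longrightarrow> mem s' = mem s \<Longrightarrow> regs s' 3 = 2 * Suc (lg n) \<Longrightarrow>
       T \<le> T' + 20 * Suc (lg n) \<Longrightarrow> Q s' T'"
  shows "wp w compute_slack Q s T"
proof -
  have "wp w double_loop Q (State ((regs s)(4 := 1, 3 := 2)) (mem s)) (T - 4)"
  proof (rule wp_double_loop[OF big, where j = 0])
    fix s' T'
    assume *: "same_regs {3, 4} (State ((regs s)(4 := 1, 3 := 2)) (mem s)) s'"
      "mem s' = mem (State ((regs s)(4 := 1, 3 := 2)) (mem s))" "regs s' 3 = 2 * Suc (lg n)"
      "T - 4 \<le> T' + 12 * Suc (lg n - 0)"
    show "Q s' T'"
    proof (rule Q)
      show "T \<le> T' + 20 * Suc (lg n)" using *(4) by simp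
    qed (use * in \<open>simp_all add: same_regs_def\<close>)
  qed (use s T in simp_all)
  then show ?thesis
    using s T big_lit[OF big] by (simp add: compute_slack_def)
qed

section \<open>Writing a changed out-degree to the trees\<close>

definition refresh_body :: com where
  "refresh_body =
     SetReg 11 (Load (eL (Reg 10) (Reg 16))) ;;
     set_leaf ;;
     SetReg 16 (Op OpAdd (Reg 16) (Lit 1))"

definition refresh_loop :: com where
  "refresh_loop = While (Op OpLess (Reg 16) (Load (Reg 10))) refresh_body"

definition refresh :: com where
  "refresh = SetReg 7 (Load (Reg 10)) ;; SetReg 16 (Lit 0) ;; refresh_loop"

lemmas refresh_loop_unfold =
  wp_While[of _ "Op OpLess (Reg 16) (Load (Reg 10))" refresh_body, folded refresh_loop_def]

text \<open>Progress is expressed through list positions: the tree of an out-neighbour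
  \<open>v\<close> holds the new degree of \<open>u\<close> exactly when the position of
  \<open>v\<close> is below \<open>i\<close>; the other trees still hold
  \<open>key u\<close>.\<close>

lemma wp_refresh_loop:
  assumes big: "big n w" and u: "u < n"
  shows "regs s 0 = n \<Longrightarrow> regs s 10 = u \<Longrightarrow> regs s 7 = outdeg D u \<Longrightarrow> regs s 16 = i \<Longrightarrow>
    i \<le> outdeg D u \<Longrightarrow> list_rep n D (mem s) \<Longrightarrow>
    (\<And>v. v < n \<Longrightarrow> tree_rep n v (\<lambda>x. if (x, v) \<in> D
       then if x = u \<and> mem s (adP n u v) < i then outdeg D u else key x else 0) (mem s)) \<Longrightarrow>
    220 * (Suc (lg n) * Suc (outdeg D u - i)) \<le> T \<Longrightarrow>
    (\<And>s' T'. same_regs {8, 9, 11, 16} s s' \<Longrightarrow> rep n D (key(u := outdeg D u)) (mem s') \<Longrightarrow>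
       T \<le> T' + 220 * (Suc (lg n) * Suc (outdeg D u - i)) \<Longrightarrow> Q s' T') \<Longrightarrow>
    wp w refresh_loop Q s T"
proof (induction "outdeg D u - i" arbitrary: i s T rule: less_induct)
  case less
  have D: "D \<subseteq> {..<n} \<times> {..<n}" using less.prems(6) by (simp add: list_rep_def)
  have deg: "mem s u = outdeg D u" using list_rep_outdeg(1)[OF less.prems(6) u] by simp
  show ?case
  proof (cases "i < outdeg D u")
    case False
    then have i: "i = outdeg D u" using less.prems(5) by simp
    have P: "mem s (adP n u v) < outdeg D u" if "(u, v) \<in> D" for v
      using less.prems(6) that unfolding list_rep_def deg[symmetric] by blast
    have "rep n D (key(u := outdeg D u)) (mem s)"
      unfolding rep_def
    proof (intro conjI allI impI)
      fix v assume v: "v < n"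
      have "(\<lambda>x. if (x, v) \<in> D then if x = u \<and> mem s (adP n u v) < i then outdeg D u else key x else 0)
          = (\<lambda>x. if (x, v) \<in> D then (key(u := outdeg D u)) x else 0)"
        using P[of v] i by (intro ext) auto
      then show "tree_rep n v (\<lambda>x. if (x, v) \<in> D then (key(u := outdeg D u)) x else 0) (mem s)"
        using less.prems(7)[OF v] by simp
    qed (use less.prems(6) in simp)
    then have "Q s (T - 5)"
      using i by (intro less.prems(9)) (simp_all add: same_regs_def)
    then show ?thesis
      using less.prems(2,4,8) deg i by (subst refresh_loop_unfold) simp
  next
    case True
    have dn: "outdeg D u \<le> n" using outdeg_le[OF D] .
    define y where "y = mem s (adL n u i)"
    have y: "y < n" "(u, y) \<in> D" "mem s (adP n u y) = i"
      using less.prems(6) u True deg unfolding list_rep_def y_def by auto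
    define s1 where "s1 = State ((regs s)(11 := y)) (mem s)"
    have wp1: "wp w set_leaf (wp w (SetReg 16 (Op OpAdd (Reg 16) (Lit 1))) (wp w refresh_loop Q)) s1 (T - t)"
      if t: "t \<le> 20" for t
    proof (rule wp_set_leaf[OF big, of s1 y u])
      show "tree_rep n y (\<lambda>x. if (x, y) \<in> D
          then if x = u \<and> mem s (adP n u y) < i then outdeg D u else key x else 0) (mem s1)"
        using less.prems(7)[OF y(1)] by (simp add: s1_def)
      show "180 * Suc (lg n) \<le> T - t" using less.prems(8) t True by simp
    next
      fix s' T'
      assume *: "same_regs {8, 9} s1 s'" "tree_rep n y ((\<lambda>x. if (x, y) \<in> D
          then if x = u \<and> mem s (adP n u y) < i then outdeg D u else key x else 0)(u := regs s1 7)) (mem s')"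
        "same_off_tree n y (mem s1) (mem s')" "T - t \<le> T' + 180 * Suc (lg n)"
      have r16: "regs s' 16 = i" "regs s' 0 = n" "regs s' 10 = u" "regs s' 7 = outdeg D u"
        using *(1) less.prems by (simp_all add: same_regs_def s1_def)
      define L where "L = Suc (lg n)"
      have S: "1 \<le> L" by (simp add: L_def)
      define X where "X = L * Suc (outdeg D u - Suc i)"
      have eq: "220 * (L * Suc (outdeg D u - i)) = 220 * X + 220 * L"
        using True by (simp add: X_def Suc_diff_Suc[symmetric])
      have time: "220 * X + 220 * L \<le> T"
        using less.prems(8)[folded L_def] eq by simp
      have T': "T \<le> T' + 180 * L + 20"
        using *(4)[folded L_def] t by (simp add: le_diff_conv)
      then have T4: "220 * X + 4 \<le> T'"
        using time S by linarith
      have P: "mem s' (adP n u v) = mem s (adP n u v)" if "v < n" for v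
        using *(3) that u unfolding same_off_tree_def by (simp add: s1_def)
      have "wp w refresh_loop Q (State ((regs s')(16 := Suc i)) (mem s')) (T' - 4)"
      proof (rule less.hyps[of "Suc i"])
        show "list_rep n D (mem (State ((regs s')(16 := Suc i)) (mem s')))"
          using list_rep_same[OF *(3)] less.prems(6) by (simp add: s1_def)
        show "220 * (Suc (lg n) * Suc (outdeg D u - Suc i)) \<le> T' - 4"
          using T4 unfolding X_def L_def by simp
      next
        fix v assume v: "v < n"
        have "tree_rep n v (\<lambda>x. if (x, v) \<in> D
            then if x = u \<and> mem s (adP n u v) < Suc i then outdeg D u else key x else 0) (mem s')"
        proof (cases "v = y")
          case True
          \<comment> \<open>\<open>y\<close> sits at position \<open>i\<close>, so raising the
            threshold to \<open>Suc i\<close> concerns the leaf of \<open>u\<close> in this tree and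
            in no other.\<close>
          have "(\<lambda>x. if (x, y) \<in> D
                then if x = u \<and> mem s (adP n u y) < Suc i then outdeg D u else key x else 0) =
              (\<lambda>x. if (x, y) \<in> D
                then if x = u \<and> mem s (adP n u y) < i then outdeg D u else key x else 0)(u := regs s1 7)"
            using y less.prems(3) by (auto simp: s1_def)
          then show ?thesis using *(2) unfolding True by simp
        next
          case False
          have "mem s (adP n u v) \<noteq> i" if "(u, v) \<in> D"
            using less.prems(6) that False unfolding list_rep_def y_def by auto
          then have "(\<lambda>x. if (x, v) \<in> D
                then if x = u \<and> mem s (adP n u v) < Suc i then outdeg D u else key x else 0) =
              (\<lambda>x. if (x, v) \<in> D
                then if x = u \<and> mem s (adP n u v) < i then outdeg D u else key x else 0)"
            by (intro ext) (auto simp: less_Suc_eq)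
          then show ?thesis
            using tree_rep_same[OF *(3), of v] less.prems(7)[OF v] False by (simp add: s1_def)
        qed
        then show "tree_rep n v (\<lambda>x. if (x, v) \<in> D
            then if x = u \<and> mem (State ((regs s')(16 := Suc i)) (mem s')) (adP n u v) < Suc i
              then outdeg D u else key x else 0) (mem (State ((regs s')(16 := Suc i)) (mem s')))"
          using P[OF v] by (simp cong: if_cong)
      next
        fix s'' T''
        assume **: "same_regs {8, 9, 11, 16} (State ((regs s')(16 := Suc i)) (mem s')) s''"
          "rep n D (key(u := outdeg D u)) (mem s'')"
          "T' - 4 \<le> T'' + 220 * (Suc (lg n) * Suc (outdeg D u - Suc i))"
        show "Q s'' T''"
        proof (rule less.prems(9))
          show "same_regs {8, 9, 11, 16} s s''"
            using **(1) *(1) by (simp add: same_regs_def s1_def)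
          show "T \<le> T'' + 220 * (Suc (lg n) * Suc (outdeg D u - i))"
            using **(3) T' S unfolding L_def[symmetric] eq X_def[symmetric] le_diff_conv by linarith
        qed (rule **(2))
      qed (use r16 True in simp_all)
      moreover have "(i + 1) mod 2 ^ w = Suc i"
        using True dn by (subst big_mod_linear[OF big]) simp_all
      ultimately show "wp w (SetReg 16 (Op OpAdd (Reg 16) (Lit 1))) (wp w refresh_loop Q) s' T'"
        using r16(1) big_lit[OF big] T4 by simp
    qed (use less.prems u y in \<open>simp_all add: s1_def\<close>)
    have "20 \<le> T" using less.prems(8) True by simp
    then show ?thesis
      using less.prems(1,2,4) deg True dn u big wp1
      by (subst refresh_loop_unfold) (simp add: refresh_body_def s1_def y_def)
  qed
qed

lemma wp_refresh:
  assumes big: "big n w" and u: "u < n" and s: "regs s 0 = n" "regs s 10 = u"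
    and rep: "rep n D key (mem s)" and T: "230 * (Suc (lg n) * Suc (outdeg D u)) \<le> T"
    and Q: "\<And>s' T'. same_regs {7, 8, 9, 11, 16} s s' \<Longrightarrow> rep n D (key(u := outdeg D u)) (mem s') \<Longrightarrow>
       T \<le> T' + 230 * (Suc (lg n) * Suc (outdeg D u)) \<Longrightarrow> Q s' T'"
  shows "wp w refresh Q s T"
proof -
  have X: "1 \<le> Suc (lg n) * Suc (outdeg D u)" by simp
  let ?s = "State ((regs s)(7 := outdeg D u, 16 := 0)) (mem s)"
  have "wp w refresh_loop Q ?s (T - 5)"
  proof (rule wp_refresh_loop[OF big u, where i = 0])
    show "220 * (Suc (lg n) * Suc (outdeg D u - 0)) \<le> T - 5"
      using T X unfolding diff_zero by linarith
  next
    fix s' T'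
    assume *: "same_regs {8, 9, 11, 16} ?s s'" "rep n D (key(u := outdeg D u)) (mem s')"
      "T - 5 \<le> T' + 220 * (Suc (lg n) * Suc (outdeg D u - 0))"
    show "Q s' T'"
    proof (rule Q)
      show "T \<le> T' + 230 * (Suc (lg n) * Suc (outdeg D u))"
        using *(3) X unfolding diff_zero by linarith
    qed (use * in \<open>simp_all add: same_regs_def\<close>)
  qed (use s rep in \<open>simp_all add: rep_def cong: if_cong\<close>)
  then show ?thesis
    using s T rep_outdeg[OF rep u] big_lit[OF big] by (simp add: refresh_def)
qed

section \<open>The arc condition and the scan of an out-list\<close>

definition bits :: "nat \<Rightarrow> nat" where
  "bits n = Suc (lg n)"

lemma bits_pos: "1 \<le> bits n"
  by (simp add: bits_def)

lemma bits_le: "big n w \<Longrightarrow> bits n \<le> 2 * n"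
  using lg_le_self[of n] by (simp add: bits_def big_def)

text \<open>With \<open>a\<close> and \<open>b\<close> the degrees of tail and head, this is the
  failure of a \<le> (1 + 1/K) b + 2, multiplied by \<open>K\<close> so that it can be tested on
  integers.\<close>

definition bad :: "nat \<Rightarrow> nat \<Rightarrow> nat \<Rightarrow> bool" where
  "bad K a b \<longleftrightarrow> (K + 1) * b + 2 * K < K * a"

definition eBad :: "expr \<Rightarrow> expr \<Rightarrow> expr" where
  "eBad a b = Op OpLess (Op OpAdd (Op OpMul (Op OpAdd (Reg 3) (Lit 1)) b) (Op OpMul (Lit 2) (Reg 3)))
     (Op OpMul (Reg 3) a)"

lemma expr_cost_eBad [simp]: "expr_cost (eBad a b) = expr_cost a + expr_cost b + 11"
  by (simp add: eBad_def)

lemma expr_val_eBad: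
  assumes big: "big n w" and K: "regs s 3 = 2 * bits n"
    and a: "expr_val w s a \<le> n" and b: "expr_val w s b \<le> n"
  shows "expr_val w s (eBad a b) =
    (if bad (2 * bits n) (expr_val w s a) (expr_val w s b) then 1 else 0)"
proof -
  define k where "k = 2 * bits n"
  have k: "k \<le> 4 * n" using bits_le[OF big] by (simp add: k_def)
  have n: "2 * n \<le> n * n" "0 < n" using big by (simp_all add: big_def)
  have 1: "k * expr_val w s a \<le> 4 * (n * n)"
    using mult_le_mono[OF k a] by simp
  have "(k + 1) * expr_val w s b \<le> (5 * n) * n"
    by (rule mult_le_mono) (use k n b in simp_all)
  then have 2: "(k + 1) * expr_val w s b \<le> 5 * (n * n)" by simp
  have 3: "(k + 1) * expr_val w s b + 2 * k < 100 * (n * n)" "k * expr_val w s a < 100 * (n * n)"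
    using 1 2 k n by linarith+
  have "(k + 1) mod 2 ^ w = k + 1"
    using k n by (intro big_mod_linear[OF big]) simp
  moreover have "(2 * k) mod 2 ^ w = 2 * k"
    using k n by (intro big_mod_linear[OF big]) simp
  moreover have "((k + 1) * expr_val w s b) mod 2 ^ w = (k + 1) * expr_val w s b"
    "((k + 1) * expr_val w s b + 2 * k) mod 2 ^ w = (k + 1) * expr_val w s b + 2 * k"
    "(k * expr_val w s a) mod 2 ^ w = k * expr_val w s a"
    by (rule big_mod[OF big], use 3 in linarith)+
  ultimately show ?thesis
    using K big_lit[OF big] unfolding eBad_def bad_def k_def[symmetric] by simp
qed

text \<open>The product serves as conjunction and the comparison with 0 as negation. Past the end of
  the list the second factor may read an arbitrary cell; evaluation is total and the first factor is
  then 0.\<close>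

definition scan_test :: expr where
  "scan_test = Op OpMul (Op OpLess (Reg 16) (Load (Reg 10)))
     (Op OpEq (eBad (Load (Reg 10)) (Load (Load (eL (Reg 10) (Reg 16))))) (Lit 0))"

definition scan_loop :: com where
  "scan_loop = While scan_test (SetReg 16 (Op OpAdd (Reg 16) (Lit 1)))"

definition scan :: com where
  "scan = SetReg 16 (Lit 0) ;; scan_loop"

lemmas scan_loop_unfold =
  wp_While[of _ scan_test "SetReg 16 (Op OpAdd (Reg 16) (Lit 1))", folded scan_loop_def]

lemma wp_scan_loop:
  assumes big: "big n w" and u: "u < n"
  shows "regs s 0 = n \<Longrightarrow> regs s 10 = u \<Longrightarrow> regs s 3 = 2 * bits n \<Longrightarrow> list_rep n D (mem s) \<Longrightarrow>
    regs s 16 = i \<Longrightarrow> i \<le> outdeg D u \<Longrightarrow>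
    (\<And>k. k < i \<Longrightarrow> \<not> bad (2 * bits n) (outdeg D u) (outdeg D (mem s (adL n u k)))) \<Longrightarrow>
    40 * (outdeg D u - i + 1) \<le> T \<Longrightarrow>
    (\<And>s' T'. same_regs {16} s s' \<Longrightarrow> mem s' = mem s \<Longrightarrow>
       regs s' 16 < outdeg D u \<and>
         bad (2 * bits n) (outdeg D u) (outdeg D (mem s (adL n u (regs s' 16)))) \<or>
       regs s' 16 = outdeg D u \<and>
         (\<forall>k<outdeg D u. \<not> bad (2 * bits n) (outdeg D u) (outdeg D (mem s (adL n u k)))) \<Longrightarrow>
       T \<le> T' + 40 * (outdeg D u - i + 1) \<Longrightarrow> Q s' T') \<Longrightarrow>
    wp w scan_loop Q s T"
proof (induction "outdeg D u - i" arbitrary: i s T rule: less_induct)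
  case less
  have D: "D \<subseteq> {..<n} \<times> {..<n}" using less.prems(4) by (simp add: list_rep_def)
  have deg: "mem s v = outdeg D v" if "v < n" for v
    using list_rep_outdeg(1)[OF less.prems(4) that] by simp
  have le: "outdeg D v \<le> n" for v using outdeg_le[OF D] .
  have cost: "expr_cost scan_test = 29" by (simp add: scan_test_def)
  let ?bad = "\<lambda>k. bad (2 * bits n) (outdeg D u) (outdeg D (mem s (adL n u k)))"
  have val: "expr_val w s scan_test = (if i < outdeg D u \<and> \<not> ?bad i then 1 else 0)"
  proof (cases "i < outdeg D u")
    case False
    then show ?thesis using less.prems(2,5) deg[OF u] by (simp add: scan_test_def)
  next
    case True
    have i: "i < n" using True le[of u] by simp
    have y: "mem s (adL n u i) < n"
      using less.prems(4) u True deg[OF u] unfolding list_rep_def by auto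
    have ev: "expr_val w s (Load (Reg 10)) = outdeg D u"
      "expr_val w s (Load (Load (eL (Reg 10) (Reg 16)))) = outdeg D (mem s (adL n u i))"
      using less.prems(1,2,5) u i big deg y by simp_all
    show ?thesis
      using True less.prems(2,5) deg[OF u] big_lit[OF big]
        expr_val_eBad[OF big less.prems(3), of "Load (Reg 10)" "Load (Load (eL (Reg 10) (Reg 16)))",
          unfolded ev, OF le le]
      by (simp add: scan_test_def)
  qed
  show ?case
  proof (cases "i < outdeg D u \<and> \<not> ?bad i")
    case False
    then have v0: "expr_val w s scan_test = 0" using val by auto
    have "Q s (T - 30)"
    proof (rule less.prems(9))
      show "regs s 16 < outdeg D u \<and> ?bad (regs s 16) \<or>
          regs s 16 = outdeg D u \<and> (\<forall>k<outdeg D u. \<not> ?bad k)"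
        using False less.prems(5,6,7) by (cases "i < outdeg D u") auto
    qed (simp_all add: same_regs_def)
    then show ?thesis
      using less.prems(8) v0 cost by (subst scan_loop_unfold) simp
  next
    case True
    then have v1: "expr_val w s scan_test \<noteq> 0" using val by simp
    define s1 where "s1 = State ((regs s)(16 := i + 1)) (mem s)"
    have time: "outdeg D u - i = outdeg D u - (i + 1) + 1" using True by simp
    have "wp w scan_loop Q s1 (T - 34)"
    proof (rule less.hyps[of "i + 1"])
      show "outdeg D u - (i + 1) < outdeg D u - i" using time by linarith
      show "\<not> bad (2 * bits n) (outdeg D u) (outdeg D (mem s1 (adL n u k)))" if "k < i + 1" for k
        using that True less.prems(7)[of k] by (cases "k = i") (simp_all add: s1_def)
      show "40 * (outdeg D u - (i + 1) + 1) \<le> T - 34"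
        using less.prems(8) unfolding time by simp
    next
      fix s' T'
      assume *: "same_regs {16} s1 s'" "mem s' = mem s1"
       "regs s' 16 < outdeg D u \<and>
         bad (2 * bits n) (outdeg D u) (outdeg D (mem s1 (adL n u (regs s' 16)))) \<or>
       regs s' 16 = outdeg D u \<and>
         (\<forall>k<outdeg D u. \<not> bad (2 * bits n) (outdeg D u) (outdeg D (mem s1 (adL n u k))))"
       "T - 34 \<le> T' + 40 * (outdeg D u - (i + 1) + 1)"
      show "Q s' T'"
      proof (rule less.prems(9))
        show "T \<le> T' + 40 * (outdeg D u - i + 1)"
          using *(4) unfolding time by simp
      qed (use * in \<open>simp_all add: same_regs_def s1_def\<close>)
    qed (use less.prems True in \<open>simp_all add: s1_def\<close>)
    moreover have "(i + 1) mod 2 ^ w = i + 1"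
      using True le[of u] by (intro big_mod_linear[OF big]) simp
    moreover have "40 \<le> T" using less.prems(8) unfolding time by simp
    ultimately show ?thesis
      using less.prems(5) v1 cost big_lit[OF big]
      by (subst scan_loop_unfold) (simp add: s1_def)
  qed
qed

lemma wp_scan:
  assumes big: "big n w" and u: "u < n"
    and s: "regs s 0 = n" "regs s 10 = u" "regs s 3 = 2 * bits n" and lr: "list_rep n D (mem s)"
    and T: "40 * (outdeg D u + 2) \<le> T"
    and Q: "\<And>s' T'. same_regs {16} s s' \<Longrightarrow> mem s' = mem s \<Longrightarrow>
       regs s' 16 < outdeg D u \<and> (u, mem s (adL n u (regs s' 16))) \<in> D \<and>
         bad (2 * bits n) (outdeg D u) (outdeg D (mem s (adL n u (regs s' 16)))) \<or>
       \<not> regs s' 16 < outdeg D u \<and> (\<forall>v. (u, v) \<in> D \<longrightarrow> \<not> bad (2 * bits n) (outdeg D u) (outdeg D v)) \<Longrightarrow>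
       T \<le> T' + 40 * (outdeg D u + 2) \<Longrightarrow> Q s' T'"
  shows "wp w scan Q s T"
proof -
  let ?s = "State ((regs s)(16 := 0)) (mem s)"
  have "wp w scan_loop Q ?s (T - 2)"
  proof (rule wp_scan_loop[OF big u, where i = 0])
    fix s' T'
    assume *: "same_regs {16} ?s s'" "mem s' = mem ?s"
       "regs s' 16 < outdeg D u \<and>
         bad (2 * bits n) (outdeg D u) (outdeg D (mem ?s (adL n u (regs s' 16)))) \<or>
       regs s' 16 = outdeg D u \<and>
         (\<forall>k<outdeg D u. \<not> bad (2 * bits n) (outdeg D u) (outdeg D (mem ?s (adL n u k))))"
       "T - 2 \<le> T' + 40 * (outdeg D u - 0 + 1)"
    show "Q s' T'"
    proof (rule Q)
      have "\<forall>v. (u, v) \<in> D \<longrightarrow> \<not> bad (2 * bits n) (outdeg D u) (outdeg D v)"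
        if "\<forall>k<outdeg D u. \<not> bad (2 * bits n) (outdeg D u) (outdeg D (mem s (adL n u k)))"
      proof (intro allI impI)
        fix v assume "(u, v) \<in> D"
        then have "v \<in> {v. (u, v) \<in> D}" by simp
        then obtain k where "k < mem s u" "v = mem s (adL n u k)"
          unfolding list_rep_outdeg(2)[OF lr u] by auto
        then show "\<not> bad (2 * bits n) (outdeg D u) (outdeg D v)"
          using that list_rep_outdeg(1)[OF lr u] by simp
      qed
      moreover have "(u, mem s (adL n u (regs s' 16))) \<in> D" if "regs s' 16 < outdeg D u"
        using lr u that list_rep_outdeg(1)[OF lr u] unfolding list_rep_def by auto
      ultimately show "regs s' 16 < outdeg D u \<and> (u, mem s (adL n u (regs s' 16))) \<in> D \<and>
         bad (2 * bits n) (outdeg D u) (outdeg D (mem s (adL n u (regs s' 16)))) \<or>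
       \<not> regs s' 16 < outdeg D u \<and> (\<forall>v. (u, v) \<in> D \<longrightarrow> \<not> bad (2 * bits n) (outdeg D u) (outdeg D v))"
        using *(3) by auto
    qed (use * in \<open>simp_all add: same_regs_def\<close>)
  qed (use s lr T in simp_all)
  then show ?thesis
    using s T by (simp add: scan_def)
qed

section \<open>Finding an in-neighbour of largest key\<close>

lemma tree_rep_le_root:
  assumes "tree_rep n v f m" "u < n"
  shows "f u \<le> m (adT n v 1)"
proof -
  have "1 \<le> i \<Longrightarrow> i < 2 * n \<Longrightarrow> m (adT n v i) \<le> m (adT n v 1)" for i
  proof (induction i rule: less_induct)
    case (less i)
    show ?case
    proof (cases "i = 1")
      case False
      define h where "h = i div 2"
      have h: "1 \<le> h" "h < n" "h < i" "i = 2 * h \<or> i = 2 * h + 1"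
        using False less.prems unfolding h_def by auto
      then have "m (adT n v i) \<le> m (adT n v h)"
        using assms(1) unfolding tree_rep_def inner_def by auto
      also have "\<dots> \<le> m (adT n v 1)"
        using h less.prems by (intro less.IH) simp_all
      finally show ?thesis .
    qed simp
  qed
  from this[of "n + u"] show ?thesis
    using assms unfolding tree_rep_def by simp
qed

text \<open>The current node holds the value of the root, in register 16. If the left child does not
  hold it, the right one must, so one comparison per level suffices.\<close>

definition descend_body :: com where
  "descend_body =
     SetReg 8 (Op OpAdd (Reg 8) (Reg 8)) ;;
     Cond (Op OpEq (Load (eT (Reg 10) (Reg 8))) (Reg 16)) Skip (SetReg 8 (Op OpAdd (Reg 8) (Lit 1)))"

definition descend_loop :: com where
  "descend_loop = While (Op OpLess (Reg 8) (Reg 0)) descend_body"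

definition descend :: com where
  "descend = SetReg 8 (Lit 1) ;; descend_loop"

lemmas descend_loop_unfold =
  wp_While[of _ "Op OpLess (Reg 8) (Reg 0)" descend_body, folded descend_loop_def]

lemma wp_descend_loop:
  assumes big: "big n w" and v: "v < n"
  shows "regs s 0 = n \<Longrightarrow> regs s 10 = v \<Longrightarrow> tree_rep n v f (mem s) \<Longrightarrow>
    regs s 8 = i \<Longrightarrow> 1 \<le> i \<Longrightarrow> i < 2 * n \<Longrightarrow> mem s (adT n v i) = regs s 16 \<Longrightarrow> n \<le> i * 2 ^ j \<Longrightarrow>
    40 * (j + 1) \<le> T \<Longrightarrow>
    (\<And>s' T' x. same_regs {8} s s' \<Longrightarrow> mem s' = mem s \<Longrightarrow> regs s' 8 = n + x \<Longrightarrow> x < n \<Longrightarrow> f x = regs s 16 \<Longrightarrow>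
       T \<le> T' + 40 * (j + 1) \<Longrightarrow> Q s' T') \<Longrightarrow>
    wp w descend_loop Q s T"
proof (induction j arbitrary: s i T)
  \<comment> \<open>Leaves can lie on two levels, so the descent may end while \<open>j\<close> is
    still positive; both cases of the induction use this.\<close>
  have final: "wp w descend_loop Q s T"
    if s: "tree_rep n v f (mem s)" "regs s 8 = i" "i < 2 * n" "regs s 0 = n"
      "mem s (adT n v i) = regs s 16" "40 * (j + 1) \<le> T" "n \<le> i"
      and Q: "\<And>s' T' x. same_regs {8} s s' \<Longrightarrow> mem s' = mem s \<Longrightarrow> regs s' 8 = n + x \<Longrightarrow> x < n \<Longrightarrow>
       f x = regs s 16 \<Longrightarrow> T \<le> T' + 40 * (j + 1) \<Longrightarrow> Q s' T'" for s i T j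
  proof -
    define x where "x = i - n"
    have x: "i = n + x" "x < n" using s by (simp_all add: x_def)
    have "Q s (T - 4)"
    proof (rule Q)
      show "f x = regs s 16" using s(1,5) x unfolding tree_rep_def by simp
    qed (use x s in \<open>simp_all add: same_regs_def\<close>)
    then show ?thesis
      using s x by (subst descend_loop_unfold) simp
  qed
  {
    case (0 s i T)
    then show ?case by (intro final[where j = 0 and i = i]) simp_all
  next
    case (Suc j s i T)
    show ?case
    proof (cases "i < n")
      case False
      then show ?thesis using Suc.prems by (intro final[where j = "Suc j" and i = i]) simp_all
    next
      case True
      define c where "c = (if mem s (adT n v (2 * i)) = regs s 16 then 2 * i else 2 * i + 1)"
      define s1 where "s1 = State ((regs s)(8 := c)) (mem s)"
      have "inner n v (mem s) i" using Suc.prems(3,5) True by (simp add: tree_rep_def)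
      then have c: "mem s (adT n v c) = regs s 16" "1 \<le> c" "c < 2 * n" "2 * i \<le> c"
        using Suc.prems(5,7) True by (auto simp: c_def inner_def max_def split: if_splits)
      have wp1: "wp w descend_loop Q s1 (T - t)" if "t \<le> 40" for t
      proof (rule Suc.IH[of s1 c])
        have "n \<le> 2 * i * 2 ^ j" using Suc.prems(8) by simp
        also have "\<dots> \<le> c * 2 ^ j" using c(4) by (intro mult_le_mono1)
        finally show "n \<le> c * 2 ^ j" .
        show "40 * (j + 1) \<le> T - t" using Suc.prems(9) that by simp
      next
        fix s' T' x
        assume *: "same_regs {8} s1 s'" "mem s' = mem s1" "regs s' 8 = n + x" "x < n"
          "f x = regs s1 16" "T - t \<le> T' + 40 * (j + 1)"
        show "Q s' T'"
        proof (rule Suc.prems(10)[of _ x])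
          show "T \<le> T' + 40 * (Suc j + 1)" using *(6) that by simp
        qed (use * in \<open>simp_all add: same_regs_def s1_def\<close>)
      qed (use Suc.prems c in \<open>simp_all add: s1_def\<close>)
      have m: "(i + i) mod 2 ^ w = 2 * i" "(2 * i + 1) mod 2 ^ w = 2 * i + 1"
        using big_mod_linear[OF big, of "i + i"] big_mod_linear[OF big, of "2 * i + 1"] True
        by simp_all
      have s1: "mem s (adT n v (2 * i)) = regs s 16 \<Longrightarrow> State ((regs s)(8 := 2 * i)) (mem s) = s1"
        "mem s (adT n v (2 * i)) \<noteq> regs s 16 \<Longrightarrow> State ((regs s)(8 := 2 * i + 1)) (mem s) = s1"
        by (simp_all add: s1_def c_def)
      show ?thesis
        using Suc.prems(1,2,4,9) True v big big_lit[OF big]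
        by (subst descend_loop_unfold) (simp add: descend_body_def m s1 wp1, arith?)
    qed
  }
qed

lemma wp_descend:
  assumes big: "big n w" and v: "v < n" and s: "regs s 0 = n" "regs s 10 = v"
    and tr: "tree_rep n v f (mem s)" and root: "mem s (adT n v 1) = regs s 16"
    and T: "50 * bits n \<le> T"
    and Q: "\<And>s' T' x. same_regs {8} s s' \<Longrightarrow> mem s' = mem s \<Longrightarrow> regs s' 8 = n + x \<Longrightarrow> x < n \<Longrightarrow>
       f x = regs s 16 \<Longrightarrow> T \<le> T' + 50 * bits n \<Longrightarrow> Q s' T'"
  shows "wp w descend Q s T"
proof -
  have n: "2 \<le> n" using big by (simp add: big_def)
  let ?s = "State ((regs s)(8 := 1)) (mem s)"
  have "wp w descend_loop Q ?s (T - 2)"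
  proof (rule wp_descend_loop[OF big v, where f = f and i = 1 and j = "lg n"])
    show "n \<le> 1 * 2 ^ lg n" using le_two_power_lg by simp
    show "40 * (lg n + 1) \<le> T - 2" using T by (simp add: bits_def)
  next
    fix s' T' x
    assume *: "same_regs {8} ?s s'" "mem s' = mem ?s" "regs s' 8 = n + x" "x < n"
      "f x = regs ?s 16" "T - 2 \<le> T' + 40 * (lg n + 1)"
    show "Q s' T'"
    proof (rule Q[of _ x])
      show "T \<le> T' + 50 * bits n" using *(6) by (simp add: bits_def)
    qed (use * in \<open>simp_all add: same_regs_def\<close>)
  qed (use s tr root n in simp_all)
  then show ?thesis
    using s T bits_pos[of n] big_lit[OF big] by (simp add: descend_def)
qed

section \<open>Chains of flips\<close>

lemmas wp_add_arc' = wp_add_arc[folded bits_def]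
lemmas wp_remove_arc' = wp_remove_arc[folded bits_def]
lemmas wp_refresh' = wp_refresh[folded bits_def]
lemmas wp_compute_slack' = wp_compute_slack[folded bits_def]

definition flip :: "expr \<Rightarrow> com" where
  "flip e =
     remove_arc ;;
     SetReg 14 (Reg 10) ;; SetReg 10 (Reg 11) ;; SetReg 11 (Reg 14) ;; SetReg 7 e ;;
     add_arc"

lemma wp_flip:
  assumes big: "big n w" and s: "regs s 0 = n" "regs s 10 = x" "regs s 11 = y"
    and xy: "(x, y) \<in> D" and yx: "(y, x) \<notin> D" and ne: "x \<noteq> y"
    and rep: "rep n D key (mem s)"
    and e: "\<And>s'. regs s' 0 = n \<Longrightarrow> regs s' 10 = y \<Longrightarrow> mem s' y = outdeg D y \<Longrightarrow> expr_val w s' e = key y"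
    and cost: "expr_cost e \<le> 10" and T: "600 * bits n \<le> T"
    and Q: "\<And>s' T'. same_regs {7, 8, 9, 10, 11, 12, 13, 14} s s' \<Longrightarrow>
      regs s' 10 = y \<Longrightarrow> regs s' 11 = x \<Longrightarrow>
      rep n (insert (y, x) (D - {(x, y)})) key (mem s') \<Longrightarrow> T \<le> T' + 600 * bits n \<Longrightarrow> Q s' T'"
  shows "wp w (flip e) Q s T"
proof -
  have D: "D \<subseteq> {..<n} \<times> {..<n}" using rep_subset[OF rep] .
  then have x: "x < n" and y: "y < n" using xy by auto
  show ?thesis
    unfolding flip_def wp_Seq
  proof (rule wp_remove_arc'[OF big s xy rep])
    show "280 * bits n \<le> T" using T by linarith
  next
    fix s1 T1
    assume s1: "same_regs {7, 8, 9, 12, 13} s s1" "rep n (D - {(x, y)}) key (mem s1)"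
      "T \<le> T1 + 280 * bits n"
    let ?D = "D - {(x, y)}"
    have r: "regs s1 0 = n" "regs s1 10 = x" "regs s1 11 = y"
      using s s1(1) by (simp_all add: same_regs_def)
    let ?r = "(regs s1)(14 := x, 10 := y, 11 := x)"
    have "mem s1 y = outdeg D y"
      using rep_outdeg[OF s1(2) y] outdeg_remove[OF D xy] ne by simp
    then have ev: "expr_val w (State ?r (mem s1)) e = key y"
      using r by (intro e) simp_all
    let ?s2 = "State (?r(7 := key y)) (mem s1)"
    have "wp w add_arc Q ?s2 (T1 - (7 + expr_cost e))"
    proof (rule wp_add_arc'[OF big, where x = y and y = x and D = ?D and key = key])
      show "250 * bits n \<le> T1 - (7 + expr_cost e)"
        using T s1(3) bits_pos[of n] cost by simp
    next
      fix s' T'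
      assume *: "same_regs {8, 9} ?s2 s'" "rep n (insert (y, x) ?D) key (mem s')"
        "T1 - (7 + expr_cost e) \<le> T' + 250 * bits n"
      show "Q s' T'"
      proof (rule Q)
        show "same_regs {7, 8, 9, 10, 11, 12, 13, 14} s s'"
          using *(1) s1(1) by (simp add: same_regs_def)
        show "regs s' 10 = y" "regs s' 11 = x" using *(1) by (simp_all add: same_regs_def)
        show "T \<le> T' + 600 * bits n"
          using *(3) s1(3) cost bits_pos[of n] by simp
      qed (rule *(2))
    qed (use r x y s1(2) yx in simp_all)
    moreover have "7 + expr_cost e \<le> T1"
      using T s1(3) bits_pos[of n] cost by linarith
    ultimately show "wp w (SetReg 14 (Reg 10)) (wp w (SetReg 10 (Reg 11)) (wp w (SetReg 11 (Reg 14))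
        (wp w (SetReg 7 e) (wp w add_arc Q)))) s1 T1"
      using r ev by (simp, arith)
  qed
qed

lemma not_bad_mono: "\<not> bad K a b \<Longrightarrow> a' \<le> a \<Longrightarrow> b \<le> b' \<Longrightarrow> \<not> bad K a' b'"
  unfolding bad_def
  using mult_le_mono2[of a' a K] mult_le_mono2[of b b' "K + 1"] by linarith

text \<open>A flipped arc points from the smaller to the larger frozen degree, and a new edge is
  oriented likewise up to equality, so neither violates the condition.\<close>

lemma not_bad_le: "a \<le> b \<Longrightarrow> \<not> bad K a b"
  unfolding bad_def add_mult_distrib using mult_le_mono2[of a b K] by linarith

lemma bad_insert:
  assumes "bad K (d + 1) b"
  shows "(K + 1) * (b + 1) \<le> K * d" "b + 1 \<le> d"
proof -
  show *: "(K + 1) * (b + 1) \<le> K * d" using assms by (simp add: bad_def algebra_simps)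
  show "b + 1 \<le> d"
  proof (rule ccontr)
    assume "\<not> ?thesis"
    then have "K * d \<le> K * b" by (intro mult_le_mono2) simp
    with * show False unfolding add_mult_distrib distrib_left by linarith
  qed
qed

lemma bad_delete:
  assumes "bad K a (b - 1)"
  shows "b < a"
proof (rule ccontr)
  assume "\<not> ?thesis"
  then have "K * a \<le> K * (b - 1 + 1)" by (intro mult_le_mono2) simp
  with assms show False unfolding bad_def add_mult_distrib distrib_left by linarith
qed

definition chain_inv :: "nat \<Rightarrow> nat set set \<Rightarrow> (nat \<Rightarrow> nat) \<Rightarrow> (nat \<times> nat) set \<Rightarrow> state \<Rightarrow> bool" where
  "chain_inv n E key D s \<longleftrightarrow> regs s 0 = n \<and> regs s 3 = 2 * bits n \<and> regs s 10 < n \<and>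
     orientation_of E D \<and> rep n D key (mem s) \<and>
     (\<forall>x y. (x, y) \<in> D \<longrightarrow> x \<noteq> y \<and> \<not> bad (2 * bits n) (key x) (key y))"

text \<open>Common exit condition of both loops: the keys are outdated at the current vertex at
  most, where an insertion chain may have raised the out-degree to \<open>N + 1\<close>.\<close>

definition chain_end :: "nat \<Rightarrow> nat set set \<Rightarrow> (nat \<Rightarrow> nat) \<Rightarrow> nat \<Rightarrow> (nat \<times> nat) set \<Rightarrow> state \<Rightarrow> bool" where
  "chain_end n E key N D s \<longleftrightarrow> regs s 0 = n \<and> regs s 10 < n \<and>
     orientation_of E D \<and> rep n D key (mem s) \<and>
     key(regs s 10 := outdeg D (regs s 10)) = outdeg D \<and> outdeg D (regs s 10) \<le> N + 1 \<and>
     (\<forall>x y. (x, y) \<in> D \<longrightarrow> x \<noteq> y \<and> \<not> bad (2 * bits n) (outdeg D x) (outdeg D y))"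

section \<open>Insertion chains\<close>

definition insert_body :: com where
  "insert_body = scan ;;
     Cond (Op OpLess (Reg 16) (Load (Reg 10)))
       (SetReg 11 (Load (eL (Reg 10) (Reg 16))) ;; flip (Load (Reg 10)))
       (SetReg 15 (Lit 0))"

definition insert_loop :: com where
  "insert_loop = While (Reg 15) insert_body"

lemmas insert_loop_unfold = wp_While[of _ "Reg 15" insert_body, folded insert_loop_def]

text \<open>
  Out-degrees decrease by a factor of \<open>1 + 1 / K\<close> along the chain, hence the scans take
  \<open>O (K d)\<close> time altogether.
\<close>

definition insert_cost :: "nat \<Rightarrow> nat \<Rightarrow> nat" where
  "insert_cost B d = 40 * ((2 * B + 1) * (d + 1)) + 800 * (B * (d + 1))"

text \<open>With \<open>K = 2 * B\<close>, the first hypothesis lets the potential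
  \<open>(K + 1) * (d + 1)\<close> drop by at least \<open>d + 1\<close>, which pays for the scan;
  the second lets \<open>B * (d + 1)\<close> drop by \<open>B\<close>, which pays for the
  flip.\<close>

lemma insert_cost_step:
  assumes "(2 * B + 1) * (b + 1) \<le> 2 * B * d" "b + 1 \<le> d"
  shows "insert_cost B b + 40 * (d + 1) + 800 * B \<le> insert_cost B d"
proof -
  have "B * (b + 1) \<le> B * d" using assms(2) by (rule mult_le_mono2)
  then have "insert_cost B b \<le> 40 * (2 * B * d) + 800 * (B * d)"
    using assms(1) unfolding insert_cost_def by linarith
  then show ?thesis unfolding insert_cost_def by (simp add: algebra_simps)
qed

lemma insert_cost_ge: "40 * (d + 1) + 800 * B \<le> insert_cost B d"
  unfolding insert_cost_def by (simp add: algebra_simps)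

lemma insert_cost_mono: "d \<le> d' \<Longrightarrow> insert_cost B d \<le> insert_cost B d'"
  unfolding insert_cost_def by (intro add_mono mult_le_mono2) simp_all

lemma insert_cost_le: "1 \<le> B \<Longrightarrow> insert_cost B d \<le> 1000 * (B * (d + 1))"
  unfolding insert_cost_def using mult_le_mono1[of 1 B "d + 1"] by (simp add: algebra_simps)

lemma wp_insert_loop:
  assumes big: "big n w" and N: "\<And>x. key x \<le> N"
  shows "regs s 10 = u \<Longrightarrow> regs s 15 \<noteq> 0 \<Longrightarrow> chain_inv n E key D s \<Longrightarrow>
    outdeg D = key(u := key u + 1) \<Longrightarrow> insert_cost (bits n) (key u) \<le> T \<Longrightarrow>
    (\<And>s' T' D'. chain_end n E key N D' s' \<Longrightarrow> T \<le> T' + insert_cost (bits n) (key u) \<Longrightarrow> Q s' T') \<Longrightarrow>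
    wp w insert_loop Q s T"
proof (induction "key u" arbitrary: u s D T rule: less_induct)
  case less
  let ?K = "2 * bits n"
  have s: "regs s 0 = n" "regs s 3 = ?K" "u < n" and or: "orientation_of E D"
    and rep: "rep n D key (mem s)"
    and ok: "\<And>x y. (x, y) \<in> D \<Longrightarrow> x \<noteq> y \<and> \<not> bad ?K (key x) (key y)"
    using less.prems(1,3) unfolding chain_inv_def by auto
  have D: "D \<subseteq> {..<n} \<times> {..<n}" using rep_subset[OF rep] .
  have du: "outdeg D u = key u + 1" using less.prems(4) by simp
  have cost: "40 * (key u + 1) + 800 * bits n \<le> T"
    using insert_cost_ge[of "key u" "bits n"] less.prems(5) by linarith
  note B = bits_pos[of n]
  have "wp w scan (wp w (Cond (Op OpLess (Reg 16) (Load (Reg 10)))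
       (SetReg 11 (Load (eL (Reg 10) (Reg 16))) ;; flip (Load (Reg 10)))
       (SetReg 15 (Lit 0))) (wp w insert_loop Q)) s (T - 2)"
  proof (rule wp_scan[OF big s(3,1) less.prems(1) s(2)])
    show "list_rep n D (mem s)" using rep by (simp add: rep_def)
    show "40 * (outdeg D u + 2) \<le> T - 2" unfolding du using cost B by simp
  next
    fix s1 T1
    assume s1: "same_regs {16} s s1" "mem s1 = mem s" and res:
      "regs s1 16 < outdeg D u \<and> (u, mem s (adL n u (regs s1 16))) \<in> D \<and>
         bad ?K (outdeg D u) (outdeg D (mem s (adL n u (regs s1 16)))) \<or>
       \<not> regs s1 16 < outdeg D u \<and> (\<forall>v. (u, v) \<in> D \<longrightarrow> \<not> bad ?K (outdeg D u) (outdeg D v))"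
      and T1: "T - 2 \<le> T1 + 40 * (outdeg D u + 2)"
    have r: "regs s1 0 = n" "regs s1 3 = ?K" "regs s1 10 = u" "regs s1 15 \<noteq> 0"
      using s less.prems(1,2) s1(1) by (simp_all add: same_regs_def)
    have mu: "mem s1 u = outdeg D u" using rep_outdeg[OF rep s(3)] s1(2) by simp
    have T1': "T \<le> T1 + 40 * (key u + 1) + 82" using T1 unfolding du by simp
    show "wp w (Cond (Op OpLess (Reg 16) (Load (Reg 10)))
       (SetReg 11 (Load (eL (Reg 10) (Reg 16))) ;; flip (Load (Reg 10)))
       (SetReg 15 (Lit 0))) (wp w insert_loop Q) s1 T1"
    proof (cases "regs s1 16 < outdeg D u")
      case True
      define y where "y = mem s (adL n u (regs s1 16))"
      have uy: "(u, y) \<in> D" and bd: "bad ?K (outdeg D u) (outdeg D y)"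
        using res True unfolding y_def by auto
      have y: "y < n" "u \<noteq> y" using uy D ok by auto
      have bd': "bad ?K (key u + 1) (key y)" using bd y less.prems(4) by simp
      note dec = bad_insert[OF bd']
      have yu: "(y, u) \<notin> D" using orientation_of_antisym[OF or uy] y by auto
      let ?D = "insert (y, u) (D - {(u, y)})"
      \<comment> \<open>The removal gives \<open>u\<close> its frozen degree back, so the surplus
        sits at \<open>y\<close> alone.\<close>
      have od: "outdeg ?D = key(y := key y + 1)"
      proof -
        have "outdeg (D - {(u, y)}) = key"
          using outdeg_remove[OF D uy] less.prems(4) by simp
        then show ?thesis
          using outdeg_insert[OF order_trans[OF Diff_subset D], of y u "{(u, y)}"] yu by (simp add: Suc_eq_plus1)
      qed
      have "wp w (flip (Load (Reg 10))) (wp w insert_loop Q) (State ((regs s1)(11 := y)) (mem s1)) (T1 - t)"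
        if t: "t \<le> 20" for t
      proof (rule wp_flip[OF big, where x = u and y = y and D = D and key = key])
        show "600 * bits n \<le> T1 - t" using cost T1' t B by simp
      next
        fix s2 T2
        assume s2: "same_regs {7, 8, 9, 10, 11, 12, 13, 14} (State ((regs s1)(11 := y)) (mem s1)) s2"
          "regs s2 10 = y" "rep n ?D key (mem s2)" "T1 - t \<le> T2 + 600 * bits n"
        have time: "insert_cost (bits n) (key y) + 40 * (key u + 1) + 800 * bits n \<le>
            insert_cost (bits n) (key u)"
          by (rule insert_cost_step) (use dec in simp_all)
        have T2: "T \<le> T2 + 40 * (key u + 1) + 800 * bits n"
          using T1' s2(4) t B by simp
        show "wp w insert_loop Q s2 T2"
        proof (rule less.hyps[of y s2 ?D])
          show "key y < key u" using dec by simp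
          show "regs s2 10 = y" "regs s2 15 \<noteq> 0"
            using s2(1,2) r by (simp_all add: same_regs_def)
          have "\<not> bad ?K (key y) (key u)" using dec by (intro not_bad_le) simp
          then show "chain_inv n E key ?D s2"
            unfolding chain_inv_def
            using s2 r ok y orientation_of_flip[OF or uy] by (auto simp: same_regs_def)
          show "insert_cost (bits n) (key y) \<le> T2" using time less.prems(5) T2 by linarith
        next
          fix s' T' D'
          assume end_s': "chain_end n E key N D' s'" "T2 \<le> T' + insert_cost (bits n) (key y)"
          show "Q s' T'"
          proof (rule less.prems(6)[OF end_s'(1)])
            show "T \<le> T' + insert_cost (bits n) (key u)" using time T2 end_s'(2) by linarith
          qed
        qed (rule od)
      qed (use r s uy yu y rep s1(2) less.prems(4) in simp_all)
      moreover have "20 \<le> T1" using cost T1' B by linarith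
      moreover have "outdeg D u \<le> n" by (rule outdeg_le[OF D])
      ultimately show ?thesis
        using r True mu big s(3) s1(2) by (simp add: y_def[symmetric], arith?)
    next
      case False
      then have fine: "\<not> bad ?K (outdeg D u) (outdeg D v)" if "(u, v) \<in> D" for v
        using res that by auto
      \<comment> \<open>The scan has cleared the arcs leaving \<open>u\<close>; for all others the
        tail has its frozen degree and the head has not lost anything.\<close>
      have "\<not> bad ?K (outdeg D x) (outdeg D z)" if xz: "(x, z) \<in> D" for x z
      proof (cases "x = u")
        case True
        then show ?thesis using fine xz by simp
      next
        case False
        have "key z \<le> outdeg D z" using less.prems(4) by simp
        moreover have "outdeg D x = key x" using False less.prems(4) by simp
        ultimately show ?thesis using ok[OF xz] not_bad_mono[of ?K "key x" "key z"] by simp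
      qed
      then have "chain_end n E key N D (State ((regs s1)(15 := 0)) (mem s1))"
        unfolding chain_end_def
        using r s or rep s1(2) less.prems(4) ok N[of u] by auto
      moreover have "T \<le> T1 - 9 + insert_cost (bits n) (key u)"
        using T1' insert_cost_ge[of "key u" "bits n"] B by simp
      ultimately have "Q (State ((regs s1)(15 := 0)) (mem s1)) (T1 - 9)"
        by (intro less.prems(6))
      moreover have "20 \<le> T1" using cost T1' B by linarith
      ultimately show ?thesis
        using r False mu
        by (simp add: insert_loop_unfold[of _ _ "State ((regs s1)(15 := 0)) (mem s1)"], arith)
    qed
  qed
  moreover have "2 \<le> T" using cost B by linarith
  ultimately show ?case
    using less.prems(2) by (subst insert_loop_unfold) (simp add: insert_body_def)
qed

section \<open>Deletion chains\<close>

lemma tree_rep_bound: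
  assumes "tree_rep n v f m" "\<And>u. u < n \<Longrightarrow> f u \<le> c"
  shows "1 \<le> i \<Longrightarrow> i < 2 * n \<Longrightarrow> m (adT n v i) \<le> c"
proof (induction "2 * n - i" arbitrary: i rule: less_induct)
  case less
  show ?case
  proof (cases "i < n")
    case True
    then have "m (adT n v (2 * i)) \<le> c" "m (adT n v (2 * i + 1)) \<le> c"
      using less.prems by (auto intro!: less.hyps)
    then show ?thesis
      using assms(1) True less.prems(1) unfolding tree_rep_def inner_def by simp
  next
    case False
    define u where "u = i - n"
    have "i = n + u" "u < n" using False less.prems unfolding u_def by simp_all
    then show ?thesis using assms unfolding tree_rep_def by simp
  qed
qed

text \<open>Subtracting \<open>n\<close> turns the leaf index into the in-neighbour.
  \<open>flip\<close> exchanges the roles of registers 10 and 11, but the deficit has moved to the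
  old tail, so the chain continues from register 11.\<close>

definition delete_flip :: com where
  "delete_flip =
     SetReg 11 (Reg 10) ;; SetReg 10 (Op OpSub (Reg 8) (Reg 0)) ;;
     flip (Op OpAdd (Load (Reg 10)) (Lit 1)) ;;
     SetReg 10 (Reg 11)"

definition delete_body :: com where
  "delete_body =
     SetReg 16 (Load (eT (Reg 10) (Lit 1))) ;;
     Cond (eBad (Reg 16) (Load (Reg 10))) (descend ;; delete_flip) (SetReg 15 (Lit 0))"

definition delete_loop :: com where
  "delete_loop = While (Reg 15) delete_body"

lemmas delete_loop_unfold = wp_While[of _ "Reg 15" delete_body, folded delete_loop_def]

lemma wp_delete_loop:
  assumes big: "big n w" and N: "\<And>x. key x \<le> N"
  shows "regs s 10 = u \<Longrightarrow> regs s 15 \<noteq> 0 \<Longrightarrow> chain_inv n E key D s \<Longrightarrow>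
    outdeg D = key(u := key u - 1) \<Longrightarrow> 1 \<le> key u \<Longrightarrow> 800 * (bits n * (N - key u + 1)) \<le> T \<Longrightarrow>
    (\<And>s' T' D'. chain_end n E key N D' s' \<Longrightarrow> T \<le> T' + 800 * (bits n * (N - key u + 1)) \<Longrightarrow> Q s' T') \<Longrightarrow>
    wp w delete_loop Q s T"
proof (induction "N - key u" arbitrary: u s D T rule: less_induct)
  case less
  let ?K = "2 * bits n"
  have s: "regs s 0 = n" "regs s 3 = ?K" "u < n" and or: "orientation_of E D"
    and rep: "rep n D key (mem s)"
    and ok: "\<And>x y. (x, y) \<in> D \<Longrightarrow> x \<noteq> y \<and> \<not> bad ?K (key x) (key y)"
    using less.prems(1,3) unfolding chain_inv_def by auto
  have D: "D \<subseteq> {..<n} \<times> {..<n}" using rep_subset[OF rep] .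
  have du: "outdeg D u = key u - 1" using less.prems(4) by simp
  note B = bits_pos[of n]
  have n: "2 \<le> n" using big by (simp add: big_def)
  let ?f = "\<lambda>x. if (x, u) \<in> D then key x else 0"
  define M where "M = mem s (adT n u 1)"
  have tr: "tree_rep n u ?f (mem s)" using rep s(3) by (simp add: rep_def)
  have key_le: "key x \<le> n" if "(x, u) \<in> D" for x
    using less.prems(4) outdeg_le[OF D, of x] ok[OF that] by (simp split: if_splits)
  \<comment> \<open>The root value enters the arc test, which computes correctly only for arguments
    up to \<open>n\<close>.\<close>
  have M: "M \<le> n"
    unfolding M_def by (rule tree_rep_bound[OF tr]) (use key_le n in auto)
  have mu: "mem s u = outdeg D u" using rep_outdeg[OF rep s(3)] .
  have "bits n * 1 \<le> bits n * (N - key u + 1)" by (intro mult_le_mono2) simp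
  then have BN: "bits n \<le> bits n * (N - key u + 1)" by simp
  have cost: "800 * bits n \<le> T"
    using less.prems(6) BN by linarith
  define s1 where "s1 = State ((regs s)(16 := M)) (mem s)"
  have r: "regs s1 0 = n" "regs s1 3 = ?K" "regs s1 10 = u" "regs s1 15 \<noteq> 0" "regs s1 16 = M" "mem s1 = mem s"
    using s less.prems(1,2) by (simp_all add: s1_def)
  have val: "expr_val w s1 (eBad (Reg 16) (Load (Reg 10))) = (if bad ?K M (outdeg D u) then 1 else 0)"
    using expr_val_eBad[OF big r(2), of "Reg 16" "Load (Reg 10)"] r M mu outdeg_le[OF D, of u] by simp
  have "wp w (Cond (eBad (Reg 16) (Load (Reg 10))) (descend ;; delete_flip) (SetReg 15 (Lit 0)))
      (wp w delete_loop Q) s1 (T - 15)"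
  proof (cases "bad ?K M (outdeg D u)")
    case True
    have "wp w descend (wp w delete_flip (wp w delete_loop Q)) s1 (T - 30)"
    proof (rule wp_descend[OF big s(3) r(1,3), where f = ?f])
      show "tree_rep n u ?f (mem s1)" "mem s1 (adT n u 1) = regs s1 16"
        using tr r by (simp_all add: M_def)
      show "50 * bits n \<le> T - 30" using cost B by simp
    next
      fix s2 T2 x
      assume s2: "same_regs {8} s1 s2" "mem s2 = mem s1" "regs s2 8 = n + x" "x < n" "?f x = regs s1 16"
        "T - 30 \<le> T2 + 50 * bits n"
      have r2: "regs s2 0 = n" "regs s2 3 = ?K" "regs s2 10 = u" "regs s2 15 \<noteq> 0" "mem s2 = mem s"
        using r s2(1,2) by (simp_all add: same_regs_def)
      \<comment> \<open>A key of 0 is never too large, so the leaf found is not one of the zeros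
        that stand for missing arcs.\<close>
      have "M \<noteq> 0" using True unfolding bad_def by (intro notI) simp
      then have xu: "(x, u) \<in> D" and kx: "key x = M" using s2(5) r(5) by (auto split: if_splits)
      have xn: "x \<noteq> u" using ok[OF xu] by simp
      have dec: "key u < key x" using bad_delete[of ?K M "key u"] True unfolding du kx by simp
      have ux: "(u, x) \<notin> D" using orientation_of_antisym[OF or xu] xn by auto
      let ?D = "insert (u, x) (D - {(x, u)})"
      have od: "outdeg ?D = key(x := key x - 1)"
      proof -
        have "outdeg ?D = (outdeg (D - {(x, u)}))(u := Suc (outdeg (D - {(x, u)}) u))"
          using ux by (intro outdeg_insert[OF order_trans[OF Diff_subset D]]) simp
        also have "outdeg (D - {(x, u)}) = (outdeg D)(x := key x - 1)"
          using outdeg_remove[OF D xu] less.prems(4) xn by simp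
        also have "\<dots>(u := Suc (((outdeg D)(x := key x - 1)) u)) = key(x := key x - 1)"
          using xn less.prems(4,5) by (auto simp: Suc_eq_plus1)
        finally show ?thesis .
      qed
      define s3 where "s3 = State ((regs s2)(11 := u, 10 := x)) (mem s)"
      have "wp w (flip (Op OpAdd (Load (Reg 10)) (Lit 1))) (wp w (SetReg 10 (Reg 11)) (wp w delete_loop Q))
          s3 (T2 - 6)"
      proof (rule wp_flip[OF big, where x = x and y = u and D = D and key = key])
        show "regs s3 0 = n" "regs s3 10 = x" "regs s3 11 = u" using r2 by (simp_all add: s3_def)
        show "rep n D key (mem s3)" using rep by (simp add: s3_def)
        show "600 * bits n \<le> T2 - 6" using cost s2(6) B by simp
        show "expr_val w s' (Op OpAdd (Load (Reg 10)) (Lit 1)) = key u"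
          if "regs s' 0 = n" "regs s' 10 = u" "mem s' u = outdeg D u" for s'
        proof -
          have "key u mod 2 ^ w = key u"
            using outdeg_le[OF D, of u] du n by (intro big_mod_linear[OF big]) simp
          then show ?thesis
            using that du less.prems(5) big_lit[OF big] by simp
        qed
      next
        fix s4 T4
        assume s4: "same_regs {7, 8, 9, 10, 11, 12, 13, 14} s3 s4" "regs s4 10 = u" "regs s4 11 = x"
          "rep n ?D key (mem s4)" "T2 - 6 \<le> T4 + 600 * bits n"
        define s5 where "s5 = State ((regs s4)(10 := x)) (mem s4)"
        \<comment> \<open>The gap between the key and its upper bound \<open>N\<close> shrinks by at
          least 1, which pays for this descent and flip.\<close>
        have kN: "N - key u + 1 = (N - key x + 1) + (key x - key u)"
          using dec N[of x] by simp
        have "bits n * (N - key x + 1) + bits n * 1 \<le> bits n * (N - key u + 1)"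
          unfolding kN add_mult_distrib2[of "bits n" "N - key x + 1" "key x - key u"] using dec
          by (intro add_left_mono mult_le_mono2) simp
        then have time: "800 * (bits n * (N - key x + 1)) + 800 * bits n \<le> 800 * (bits n * (N - key u + 1))"
          by linarith
        have T4: "T \<le> T4 - 2 + 800 * bits n" using s2(6) s4(5) B by simp
        have "wp w delete_loop Q s5 (T4 - 2)"
        proof (rule less.hyps[of x s5 ?D])
          show "N - key x < N - key u" using dec N[of x] by (intro diff_less_mono2) simp_all
          show "regs s5 10 = x" "regs s5 15 \<noteq> 0"
            using s4(1) r2 by (simp_all add: s5_def s3_def same_regs_def)
          have "\<not> bad ?K (key u) (key x)" using dec by (intro not_bad_le) simp
          then show "chain_inv n E key ?D s5"
            unfolding chain_inv_def
            using s4 r2 ok xn s2(4) orientation_of_flip[OF or xu]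
            by (auto simp: same_regs_def s5_def s3_def)
          show "1 \<le> key x" using dec by simp
          show "800 * (bits n * (N - key x + 1)) \<le> T4 - 2"
            using order_trans[OF order_trans[OF time less.prems(6)] T4] by (simp only: add_le_cancel_right)
        next
          fix s' T' D'
          assume end_s': "chain_end n E key N D' s'" "T4 - 2 \<le> T' + 800 * (bits n * (N - key x + 1))"
          show "Q s' T'"
          proof (rule less.prems(7)[OF end_s'(1)])
            have "T4 - 2 + 800 * bits n \<le>
                T' + (800 * (bits n * (N - key x + 1)) + 800 * bits n)"
              using end_s'(2) unfolding add.assoc[symmetric] by (rule add_right_mono)
            also have "\<dots> \<le> T' + 800 * (bits n * (N - key u + 1))"
              using time by (rule add_left_mono)
            finally show "T \<le> T' + 800 * (bits n * (N - key u + 1))"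
              using T4 by (rule order_trans[rotated])
          qed
        qed (rule od)
        moreover have "2 \<le> T4" using cost s2(6) s4(5) B by simp
        ultimately show "wp w (SetReg 10 (Reg 11)) (wp w delete_loop Q) s4 T4"
          using s4(3) by (simp add: s5_def)
      qed (use xu ux xn in simp_all)
      moreover have "10 \<le> T2" using cost s2(6) B by simp
      moreover have "(n + x + 2 ^ w - n) mod 2 ^ w = x"
        using sub_mod[of n "n + x" "2 ^ w"] big_mod_linear[OF big, of "n + x"] s2(4) by simp
      ultimately show "wp w delete_flip (wp w delete_loop Q) s2 T2"
        using r2 s2(3) by (simp add: delete_flip_def s3_def, arith?)
    qed
    then show ?thesis using True val cost B by simp
  next
    case False
    have le: "key x \<le> M" if "(x, u) \<in> D" for x
      using tree_rep_le_root[OF tr, of x] that D unfolding M_def by auto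
    \<comment> \<open>Arcs into \<open>u\<close> are covered by the maximum \<open>M\<close>; for
      all others the head has its frozen degree and the tail has not gained anything.\<close>
    have "\<not> bad ?K (outdeg D x) (outdeg D z)" if xz: "(x, z) \<in> D" for x z
    proof (cases "z = u")
      case True
      have "outdeg D x \<le> M" using le[of x] xz ok[OF xz] True less.prems(4) by simp
      then show ?thesis using False True not_bad_mono[of ?K M "outdeg D u"] by simp
    next
      case False
      have "outdeg D x \<le> key x" "outdeg D z = key z" using False less.prems(4) by simp_all
      then show ?thesis using ok[OF xz] not_bad_mono[of ?K "key x" "key z" "outdeg D x"] by simp
    qed
    then have "chain_end n E key N D (State ((regs s1)(15 := 0)) (mem s1))"
      unfolding chain_end_def
      using r s or rep less.prems(4) ok N[of u] by auto
    moreover have "T \<le> T - 34 + 800 * (bits n * (N - key u + 1))"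
      using B cost BN by linarith
    ultimately have "Q (State ((regs s1)(15 := 0)) (mem s1)) (T - 34)"
      by (rule less.prems(7))
    then show ?thesis
      using val False r cost B
      by (simp add: delete_loop_unfold[of _ _ "State ((regs s1)(15 := 0)) (mem s)"], arith)
  qed
  moreover have "20 \<le> T" using cost B by simp
  ultimately show ?case
    using less.prems(1,2) s n big big_lit[OF big]
    by (subst delete_loop_unfold) (simp add: delete_body_def s1_def M_def del: wp_Cond, arith?)
qed

section \<open>The update programs\<close>

text \<open>Between updates the keys are the actual out-degrees, so all trees are exact and the next
  update can freeze them as they are.\<close>

definition graph_inv :: "nat \<Rightarrow> nat set set \<Rightarrow> (nat \<times> nat) set \<Rightarrow> state \<Rightarrow> bool" where
  "graph_inv n E D s \<longleftrightarrow> regs s 0 = n \<and> orientation_of E D \<and> rep n D (outdeg D) (mem s) \<and>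
     (\<forall>x y. (x, y) \<in> D \<longrightarrow> x \<noteq> y \<and> \<not> bad (2 * bits n) (outdeg D x) (outdeg D y))"

lemma wp_refresh_chain_end:
  assumes big: "big n w" and c: "chain_end n E key N D s" and T: "230 * (bits n * (N + 2)) \<le> T"
  shows "wp w refresh (\<lambda>s' T'. \<exists>D'. graph_inv n E D' s') s T"
proof -
  define u where "u = regs s 10"
  have s: "regs s 0 = n" "u < n" "orientation_of E D" "rep n D key (mem s)"
      "key(u := outdeg D u) = outdeg D" "outdeg D u \<le> N + 1"
    and ok: "\<And>x y. (x, y) \<in> D \<Longrightarrow> x \<noteq> y \<and> \<not> bad (2 * bits n) (outdeg D x) (outdeg D y)"
    using c unfolding chain_end_def u_def by auto
  show ?thesis
  proof (rule wp_refresh'[OF big s(2,1) u_def[symmetric] s(4)])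
    have "bits n * Suc (outdeg D u) \<le> bits n * (N + 2)"
      using s(6) by (intro mult_le_mono2) simp
    then show "230 * (bits n * Suc (outdeg D u)) \<le> T" using T by linarith
  next
    fix s' T'
    assume "same_regs {7, 8, 9, 11, 16} s s'" "rep n D (key(u := outdeg D u)) (mem s')"
    then have "graph_inv n E D s'"
      unfolding graph_inv_def using s ok by (auto simp: same_regs_def)
    then show "\<exists>D'. graph_inv n E D' s'" by blast
  qed
qed

definition insert_prog :: com where
  "insert_prog =
     compute_slack ;;
     Cond (Op OpLess (Load (Reg 2)) (Load (Reg 1)))
       (SetReg 10 (Reg 2) ;; SetReg 11 (Reg 1))
       (SetReg 10 (Reg 1) ;; SetReg 11 (Reg 2)) ;;
     SetReg 7 (Load (Reg 10)) ;;
     add_arc ;;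
     SetReg 15 (Lit 1) ;;
     insert_loop ;;
     refresh"

text \<open>The leaf of one endpoint in the tree of the other reveals the direction of the edge: it
  is nonzero exactly if the arc is present, as the tail of an arc has positive out-degree.\<close>

definition delete_prog :: com where
  "delete_prog =
     compute_slack ;;
     Cond (Load (eT (Reg 2) (Op OpAdd (Reg 0) (Reg 1))))
       (SetReg 10 (Reg 1) ;; SetReg 11 (Reg 2))
       (SetReg 10 (Reg 2) ;; SetReg 11 (Reg 1)) ;;
     remove_arc ;;
     SetReg 15 (Lit 1) ;;
     delete_loop ;;
     refresh"

text \<open>In units of \<open>bits n * (N + 1)\<close> the chain costs at most 1000 and the refresh
  at most 460, as its vertex may have out-degree \<open>N + 1\<close>. The slack parameter (20), the
  new arc (250) and the glue code fit into the rest of 3000.\<close>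

lemma wp_insert_prog:
  assumes big: "big n w" and inv: "graph_inv n E D s" and s: "regs s 1 = a" "regs s 2 = b"
    and ab: "a < n" "b < n" "a \<noteq> b" "{a, b} \<notin> E"
    and N: "\<And>x. outdeg D x \<le> N" and T: "3000 * (bits n * (N + 1)) \<le> T"
  shows "wp w insert_prog (\<lambda>s' T'. \<exists>D'. graph_inv n (insert {a, b} E) D' s') s T"
proof -
  let ?Q = "\<lambda>s' T'. \<exists>D'. graph_inv n (insert {a, b} E) D' s'"
  let ?K = "2 * bits n" and ?key = "outdeg D"
  have r0: "regs s 0 = n" and or: "orientation_of E D" and rep: "rep n D ?key (mem s)"
    and ok: "\<And>x y. (x, y) \<in> D \<Longrightarrow> x \<noteq> y \<and> \<not> bad ?K (outdeg D x) (outdeg D y)"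
    using inv unfolding graph_inv_def by auto
  have D: "D \<subseteq> {..<n} \<times> {..<n}" using rep_subset[OF rep] .
  note B = bits_pos[of n]
  define u v where "u = (if outdeg D b < outdeg D a then b else a)"
    and "v = (if outdeg D b < outdeg D a then a else b)"
  have uv: "u < n" "v < n" "u \<noteq> v" "{u, v} = {a, b}" "outdeg D u \<le> outdeg D v"
    using ab unfolding u_def v_def by auto
  have uvD: "(u, v) \<notin> D" using orientation_of_edge[OF or, of u v] uv(4) ab(4) by auto
  let ?D = "insert (u, v) D"
  have od: "outdeg ?D = ?key(u := ?key u + 1)"
    using outdeg_insert[OF D uvD] by (simp add: Suc_eq_plus1)
  define Z where "Z = bits n * (N + 1)"
  have BN: "bits n \<le> Z" by (simp add: Z_def)
  note T = T[folded Z_def]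
  have final: "wp w (SetReg 15 (Lit 1) ;; insert_loop ;; refresh) ?Q s2 T2"
    if s2: "regs s2 0 = n" "regs s2 3 = ?K" "regs s2 10 = u" "rep n ?D ?key (mem s2)"
      and T2: "2500 * Z \<le> T2" for s2 T2
  proof -
    let ?s = "State ((regs s2)(15 := 1)) (mem s2)"
    have ci: "insert_cost (bits n) (?key u) \<le> 1000 * Z"
      using insert_cost_le[OF B, of N, folded Z_def] insert_cost_mono[OF N[of u], of "bits n"] by linarith
    have "wp w insert_loop (wp w refresh ?Q) ?s (T2 - 2)"
    proof (rule wp_insert_loop[OF big N, where u = u and E = "insert {a, b} E" and D = ?D])
      show "regs ?s 10 = u" "regs ?s 15 \<noteq> 0" using s2 by simp_all
      have "\<not> bad ?K (?key u) (?key v)" using uv(5) by (rule not_bad_le)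
      moreover have "orientation_of (insert {a, b} E) ?D"
        using orientation_of_insert[OF or, of u v] uv(4) ab(4) by simp
      ultimately show "chain_inv n (insert {a, b} E) ?key ?D ?s"
        unfolding chain_inv_def using s2 uv(1,3) ok by auto
      show "insert_cost (bits n) (?key u) \<le> T2 - 2" using ci T2 BN B by simp
    next
      fix s' T' D'
      assume e: "chain_end n (insert {a, b} E) ?key N D' s'"
        "T2 - 2 \<le> T' + insert_cost (bits n) (?key u)"
      have "bits n * (N + 2) \<le> 2 * Z" by (simp add: Z_def algebra_simps)
      then show "wp w refresh ?Q s' T'"
        using e ci T2 BN B by (intro wp_refresh_chain_end[OF big e(1)]) simp
    qed (rule od)
    moreover have "2 \<le> T2" using T2 BN B by simp
    ultimately show ?thesis using big_lit[OF big] by simp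
  qed
  let ?rest = "SetReg 15 (Lit 1) ;; insert_loop ;; refresh"
  show ?thesis
    unfolding insert_prog_def wp_Seq[of _ compute_slack]
  proof (rule wp_compute_slack'[OF big r0])
    show "20 * bits n \<le> T" using T BN by linarith
  next
    fix s1 T1
    assume s1: "same_regs {3, 4} s s1" "mem s1 = mem s" "regs s1 3 = ?K" "T \<le> T1 + 20 * bits n"
    have r: "regs s1 0 = n" "regs s1 1 = a" "regs s1 2 = b"
      using r0 s s1(1) by (simp_all add: same_regs_def)
    have m: "mem s1 x = outdeg D x" if "x < n" for x
      using rep_outdeg[OF rep that] s1(2) by simp
    let ?s = "State ((regs s1)(10 := u, 11 := v, 7 := ?key u)) (mem s1)"
    have T1: "2900 * Z \<le> T1" using T s1(4) BN by linarith
    have wp2: "wp w add_arc (wp w ?rest ?Q) ?s (T1 - t)" if "t \<le> 20" for t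
    proof (rule wp_add_arc'[OF big, where x = u and y = v and D = D and key = ?key])
      show "250 * bits n \<le> T1 - t" using T1 BN B that by simp
    next
      fix s2 T2
      assume *: "same_regs {8, 9} ?s s2" "rep n ?D ?key (mem s2)" "T1 - t \<le> T2 + 250 * bits n"
      show "wp w ?rest ?Q s2 T2"
      proof (rule final)
        show "2500 * Z \<le> T2" using *(3) T1 BN B that by simp
      qed (use * r s1(3) in \<open>simp_all add: same_regs_def\<close>)
    qed (use r s1 uv uvD rep in simp_all)
    have "20 \<le> T1" using T1 BN B by simp
    then show "wp w (Cond (Op OpLess (Load (Reg 2)) (Load (Reg 1)))
       (SetReg 10 (Reg 2) ;; SetReg 11 (Reg 1))
       (SetReg 10 (Reg 1) ;; SetReg 11 (Reg 2)) ;;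
       SetReg 7 (Load (Reg 10)) ;; add_arc ;; ?rest) ?Q s1 T1"
      using wp2 r ab m unfolding u_def v_def wp_Seq
      by (cases "outdeg D b < outdeg D a"; simp; arith?)
  qed
qed

lemma wp_delete_prog:
  assumes big: "big n w" and inv: "graph_inv n E D s" and s: "regs s 1 = a" "regs s 2 = b"
    and ab: "a < n" "b < n" "a \<noteq> b" "{a, b} \<in> E"
    and N: "\<And>x. outdeg D x \<le> N" and T: "3000 * (bits n * (N + 1)) \<le> T"
  shows "wp w delete_prog (\<lambda>s' T'. \<exists>D'. graph_inv n (E - {{a, b}}) D' s') s T"
proof -
  let ?Q = "\<lambda>s' T'. \<exists>D'. graph_inv n (E - {{a, b}}) D' s'"
  let ?K = "2 * bits n" and ?key = "outdeg D"
  have r0: "regs s 0 = n" and or: "orientation_of E D" and rep: "rep n D ?key (mem s)"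
    and ok: "\<And>x y. (x, y) \<in> D \<Longrightarrow> x \<noteq> y \<and> \<not> bad ?K (outdeg D x) (outdeg D y)"
    using inv unfolding graph_inv_def by auto
  have D: "D \<subseteq> {..<n} \<times> {..<n}" using rep_subset[OF rep] .
  note B = bits_pos[of n]
  define u v where "u = (if (a, b) \<in> D then a else b)"
    and "v = (if (a, b) \<in> D then b else a)"
  have uv: "u < n" "v < n" "{u, v} = {a, b}"
    using ab unfolding u_def v_def by auto
  have uvD: "(u, v) \<in> D" using orientation_of_edge_cases[OF or ab(4)] unfolding u_def v_def by auto
  have pos: "1 \<le> ?key u" using outdeg_pos[OF D uvD] by simp
  let ?D = "D - {(u, v)}"
  have od: "outdeg ?D = ?key(u := ?key u - 1)" using outdeg_remove[OF D uvD] .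
  define Z where "Z = bits n * (N + 1)"
  have BN: "bits n \<le> Z" by (simp add: Z_def)
  note T = T[folded Z_def]
  have final: "wp w (SetReg 15 (Lit 1) ;; delete_loop ;; refresh) ?Q s2 T2"
    if s2: "regs s2 0 = n" "regs s2 3 = ?K" "regs s2 10 = u" "rep n ?D ?key (mem s2)"
      and T2: "2500 * Z \<le> T2" for s2 T2
  proof -
    let ?s = "State ((regs s2)(15 := 1)) (mem s2)"
    have ci: "800 * (bits n * (N - ?key u + 1)) \<le> 800 * Z"
      unfolding Z_def by (intro mult_le_mono2) simp
    have "wp w delete_loop (wp w refresh ?Q) ?s (T2 - 2)"
    proof (rule wp_delete_loop[OF big N, where u = u and E = "E - {{a, b}}" and D = ?D])
      show "regs ?s 10 = u" "regs ?s 15 \<noteq> 0" using s2 by simp_all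
      show "1 \<le> ?key u" by (rule pos)
      have "orientation_of (E - {{a, b}}) ?D"
        using orientation_of_remove[OF or uvD] uv(3) by simp
      then show "chain_inv n (E - {{a, b}}) ?key ?D ?s"
        unfolding chain_inv_def using s2 uv(1) ok by auto
      have "800 * Z \<le> T2 - 2" using T2 BN B by simp
      with ci show "800 * (bits n * (N - ?key u + 1)) \<le> T2 - 2" by (rule order_trans)
    next
      fix s' T' D'
      assume e: "chain_end n (E - {{a, b}}) ?key N D' s'"
        "T2 - 2 \<le> T' + 800 * (bits n * (N - ?key u + 1))"
      have "T2 - 2 \<le> T' + 800 * Z"
        using e(2) ci by (meson add_left_mono order_trans)
      moreover have "bits n * (N + 2) \<le> 2 * Z" by (simp add: Z_def algebra_simps)
      ultimately show "wp w refresh ?Q s' T'"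
        using T2 BN B by (intro wp_refresh_chain_end[OF big e(1)]) simp
    qed (rule od)
    moreover have "2 \<le> T2" using T2 BN B by simp
    ultimately show ?thesis using big_lit[OF big] by simp
  qed
  let ?rest = "SetReg 15 (Lit 1) ;; delete_loop ;; refresh"
  show ?thesis
    unfolding delete_prog_def wp_Seq[of _ compute_slack]
  proof (rule wp_compute_slack'[OF big r0])
    show "20 * bits n \<le> T" using T BN by linarith
  next
    fix s1 T1
    assume s1: "same_regs {3, 4} s s1" "mem s1 = mem s" "regs s1 3 = ?K" "T \<le> T1 + 20 * bits n"
    have r: "regs s1 0 = n" "regs s1 1 = a" "regs s1 2 = b"
      using r0 s s1(1) by (simp_all add: same_regs_def)
    have leaf: "mem s (adT n b (n + a)) = (if (a, b) \<in> D then outdeg D a else 0)"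
      using rep ab unfolding rep_def tree_rep_def by simp
    have na: "(n + a) mod 2 ^ w = n + a" using ab by (intro big_mod_linear[OF big]) simp
    let ?s = "State ((regs s1)(10 := u, 11 := v)) (mem s1)"
    have T1: "2900 * Z \<le> T1" using T s1(4) BN by linarith
    have wp2: "wp w remove_arc (wp w ?rest ?Q) ?s (T1 - t)" if "t \<le> 30" for t
    proof (rule wp_remove_arc'[OF big, where x = u and y = v and D = D and key = ?key])
      show "280 * bits n \<le> T1 - t" using T1 BN B that by simp
    next
      fix s2 T2
      assume *: "same_regs {7, 8, 9, 12, 13} ?s s2" "rep n ?D ?key (mem s2)" "T1 - t \<le> T2 + 280 * bits n"
      show "wp w ?rest ?Q s2 T2"
      proof (rule final)
        show "2500 * Z \<le> T2" using *(3) T1 BN B that by simp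
      qed (use * r s1(3) in \<open>simp_all add: same_regs_def\<close>)
    qed (use r s1 uv uvD rep in simp_all)
    have "30 \<le> T1" using T1 BN B by simp
    then show "wp w (Cond (Load (eT (Reg 2) (Op OpAdd (Reg 0) (Reg 1))))
       (SetReg 10 (Reg 1) ;; SetReg 11 (Reg 2))
       (SetReg 10 (Reg 2) ;; SetReg 11 (Reg 1)) ;;
       remove_arc ;; ?rest) ?Q s1 T1"
      using wp2 r ab leaf na big s1(2) pos unfolding u_def v_def wp_Seq
      by (cases "(a, b) \<in> D"; simp; arith?)
  qed
qed

section \<open>The invariant along arbitrary update sequences\<close>

lemma graph_inv_load_args: "graph_inv n E D (load_args a b s) \<longleftrightarrow> graph_inv n E D s"
  by (simp add: graph_inv_def load_args_def)

lemma graph_inv_update: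
  assumes big: "big n w" and inv: "graph_inv n E D s" and valid: "valid_update n E x"
    and N: "\<And>y. outdeg D y \<le> N"
  shows "\<exists>t s' D'. exec_update w (insert_prog, delete_prog) x s t s' \<and>
    t \<le> 3000 * (bits n * (N + 1)) \<and> graph_inv n (apply_update E x) D' s'"
proof (cases x)
  case (Insert a b)
  have "wp w insert_prog (\<lambda>s' T'. \<exists>D'. graph_inv n (insert {a, b} E) D' s') (load_args a b s)
      (3000 * (bits n * (N + 1)))"
    by (rule wp_insert_prog[where D = D and N = N])
      (use big inv valid N Insert in \<open>simp_all add: graph_inv_load_args, simp_all add: load_args_def\<close>)
  then show ?thesis unfolding wp_def Insert by auto
next
  case (Delete a b)
  have "wp w delete_prog (\<lambda>s' T'. \<exists>D'. graph_inv n (E - {{a, b}}) D' s') (load_args a b s)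
      (3000 * (bits n * (N + 1)))"
    by (rule wp_delete_prog[where D = D and N = N])
      (use big inv valid N Delete in \<open>simp_all add: graph_inv_load_args, simp_all add: load_args_def\<close>)
  then show ?thesis unfolding wp_def Delete by auto
qed

lemma graph_inv_initial: "graph_inv n {} {} (initial_state n)"
proof -
  have "outdeg {} = (\<lambda>_. 0)" by (simp add: outdeg_def fun_eq_iff)
  then show ?thesis
    by (simp add: graph_inv_def initial_state_def orientation_of_def bij_betw_def rep_def
        list_rep_empty tree_rep_def inner_def)
qed

text \<open>The correctness proof only yields some run; determinism identifies it with the run by
  which the state was reached.\<close>

lemma graph_inv_reachable:
  assumes "reachable w (insert_prog, delete_prog) n E s" "big n w"
  shows "\<exists>D. graph_inv n E D s"
  using assms(1)
proof induction
  case start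
  then show ?case using graph_inv_initial by blast
next
  case (step E s x t s')
  then obtain D where inv: "graph_inv n E D s" by blast
  then have "D \<subseteq> {..<n} \<times> {..<n}" by (auto simp: graph_inv_def dest: rep_subset)
  then have "outdeg D y \<le> n" for y by (rule outdeg_le)
  from graph_inv_update[OF assms(2) inv step.hyps(2) this] obtain t' s'' D'
    where "exec_update w (insert_prog, delete_prog) x s t' s''"
      "graph_inv n (apply_update E x) D' s''" by blast
  moreover from this(1) step.hyps(3) have "s'' = s'"
    by (cases x) (auto dest: exec_deterministic)
  ultimately show ?case by blast
qed

lemma graph_inv_stores:
  assumes "graph_inv n E D s"
  shows "stores_orientation n s D"
proof -
  have lr: "list_rep n D (mem s)" using assms by (simp add: graph_inv_def rep_def)
  then have D: "D \<subseteq> {..<n} \<times> {..<n}" by (simp add: list_rep_def)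
  have "D = {(u, mem s (n + u * n + i)) |u i. u < n \<and> i < mem s u}"
  proof (intro set_eqI iffI)
    fix e assume "e \<in> D"
    obtain u v where e: "e = (u, v)" by force
    have u: "u < n" using \<open>e \<in> D\<close> D e by auto
    have "v \<in> {v. (u, v) \<in> D}" using \<open>e \<in> D\<close> e by simp
    then show "e \<in> {(u, mem s (n + u * n + i)) |u i. u < n \<and> i < mem s u}"
      unfolding list_rep_outdeg(2)[OF lr u] using u e by (auto simp: adL_def)
  next
    fix e assume "e \<in> {(u, mem s (n + u * n + i)) |u i. u < n \<and> i < mem s u}"
    then obtain u i where "e = (u, mem s (n + u * n + i))" "u < n" "i < mem s u" by blast
    then show "e \<in> D" using lr unfolding list_rep_def adL_def by auto
  qed
  then show ?thesis
    unfolding stores_orientation_def using list_rep_outdeg(1)[OF lr] by simp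
qed

section \<open>From word length and binary logarithms to natural logarithms\<close>

lemma big_of_log:
  assumes "2 \<le> n" "10 * log 2 (real n) \<le> real w"
  shows "big n w"
proof -
  have "real n ^ 10 = real n powr 10" using assms(1) by (simp add: powr_numeral)
  also have "\<dots> = (2 powr log 2 (real n)) powr 10" using assms(1) by simp
  also have "\<dots> = 2 powr (10 * log 2 (real n))"
    by (simp only: powr_powr mult.commute[of "10 :: real"])
  also have "\<dots> \<le> 2 powr real w" using assms(2) by simp
  also have "\<dots> = real (2 ^ w)" by (simp add: powr_realpow)
  finally have "real (n ^ 10) \<le> real (2 ^ w)" by simp
  then have *: "n ^ 10 \<le> 2 ^ w" by (simp only: of_nat_le_iff)
  \<comment> \<open>The word length gives \<open>n ^ 10 \<le> 2 ^ w\<close>; eight of the ten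
    factors, each at least 2, absorb the constant 100.\<close>
  have "(2 :: nat) ^ 8 \<le> n ^ 8" using assms(1) by (intro power_mono) simp_all
  then have "100 * (n * n) \<le> n ^ 8 * (n * n)" by (intro mult_le_mono1) simp
  also have "\<dots> = n ^ 10" by (simp add: power_numeral_reduce mult_ac)
  finally show ?thesis using * assms(1) unfolding big_def by simp
qed

lemma ln_le_bits:
  assumes "2 \<le> n"
  shows "ln (real n) \<le> real (bits n)"
proof -
  have "real n \<le> real (2 ^ lg n)" using le_two_power_lg[of n] by (simp only: of_nat_le_iff)
  then have "ln (real n) \<le> ln (2 ^ lg n)" using assms by simp
  also have "\<dots> = real (lg n) * ln 2" by (simp add: ln_realpow)
  also have "\<dots> \<le> real (lg n) * 1" using ln_2_less_1 by (intro mult_left_mono) simp_all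
  finally show ?thesis by (simp add: bits_def)
qed

lemma half_le_ln: "2 \<le> n \<Longrightarrow> 1 / 2 \<le> ln (real n)"
proof -
  assume "2 \<le> n"
  then have "ln 2 \<le> ln (real n)" by simp
  \<comment> \<open>This is ln (1 + x) \<le> x at x = -1/2, that is, - ln 2 \<le> -1/2.\<close>
  moreover have "1 / 2 \<le> ln (2 :: real)"
    using ln_add_one_self_le_self2[of "- (1 / 2)"] ln_div[of 1 2] by simp
  ultimately show ?thesis by linarith
qed

text \<open>By minimality \<open>2 ^ (lg n - 1)\<close> is below \<open>n\<close> for positive
  \<open>lg n\<close>, so \<open>lg n\<close> is at most 1 + ln n / ln 2; now ln 2 is at least 1/2,
  and 1 is at most 2 ln n.\<close>

lemma lg_le_ln:
  assumes "2 \<le> n"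
  shows "real (lg n) \<le> 4 * ln (real n)"
proof (cases "lg n")
  case 0
  then show ?thesis using assms by simp
next
  case (Suc k)
  have "\<not> n \<le> 2 ^ k" using lg_le[of n k] Suc by auto
  then have "real (2 ^ k) \<le> real n" by (simp only: of_nat_le_iff)
  then have "ln (2 ^ k) \<le> ln (real n)" using assms by simp
  then have "real k * ln 2 \<le> ln (real n)" by (simp add: ln_realpow)
  moreover have "real k * (1 / 2) \<le> real k * ln 2"
    using half_le_ln[of 2] by (intro mult_left_mono) simp_all
  ultimately show ?thesis using Suc half_le_ln[OF assms] by simp
qed

lemma graph_inv_outdeg_bound:
  assumes n: "2 \<le> n" and inv: "graph_inv n E D s" and u: "u < n"
  shows "real (outdeg D u) \<le> 4 * max_density {..<n} E + 16 * ln (real n)"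
proof -
  have "real (outdeg D u) \<le> 4 * max_density {..<n} E + 4 * real (lg n)"
  proof (rule outdeg_le_max_density[OF _ _ _ _ le_two_power_lg u])
    show "D \<subseteq> {..<n} \<times> {..<n}" "orientation_of E D"
      using inv by (auto simp: graph_inv_def dest: rep_subset)
    show "2 * bits n = 2 * lg n + 2" by (simp add: bits_def)
    show "2 * bits n * outdeg D x \<le> (2 * bits n + 1) * outdeg D y + 2 * (2 * bits n)"
      if "(x, y) \<in> D" for x y
      using inv that unfolding graph_inv_def bad_def by (meson not_less)
  qed
  then show ?thesis using lg_le_ln[OF n] by linarith
qed

lemma graph_inv_arc:
  assumes n: "2 \<le> n" and inv: "graph_inv n E D s" and uv: "(u, v) \<in> D"
  shows "real (outdeg D u) \<le> (1 + 1 / (2 * ln (real n))) * real (outdeg D v) + 2"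
proof -
  define K where "K = 2 * bits n"
  have K: "2 * ln (real n) \<le> real K" using ln_le_bits[OF n] by (simp add: K_def)
  have pos: "0 < ln (real n)" using half_le_ln[OF n] by linarith
  have "K * outdeg D u \<le> (K + 1) * outdeg D v + 2 * K"
    using inv uv unfolding graph_inv_def bad_def K_def by (meson not_less)
  then have "real (K * outdeg D u) \<le> real ((K + 1) * outdeg D v + 2 * K)"
    by (simp only: of_nat_le_iff)
  then have "real K * real (outdeg D u) \<le> real K * ((1 + 1 / real K) * real (outdeg D v) + 2)"
    using K pos by (simp add: algebra_simps)
  then have "real (outdeg D u) \<le> (1 + 1 / real K) * real (outdeg D v) + 2"
    using K pos by (simp add: mult_le_cancel_left)
  also have "\<dots> \<le> (1 + 1 / (2 * ln (real n))) * real (outdeg D v) + 2"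
    using K pos by (intro add_right_mono mult_right_mono add_left_mono divide_left_mono) auto
  finally show ?thesis .
qed

text \<open>The out-degrees at the start of an update are governed by the old density, while its
  time is to be bounded by the new one, which a deletion may have lowered.\<close>

lemma max_density_update:
  assumes "2 \<le> n" "finite E"
  shows "max_density {..<n} E \<le> max_density {..<n} (apply_update E x) + 1"
proof (rule max_density_mono)
  show fin: "finite (apply_update E x)" using assms(2) by (cases x) auto
  fix S
  define e where "e = (case x of Insert u v \<Rightarrow> {u, v} | Delete u v \<Rightarrow> {u, v})"
  have "edges_within E S \<subseteq> insert e (edges_within (apply_update E x) S)"
    by (cases x) (auto simp: edges_within_def e_def)
  moreover have fin': "finite (edges_within (apply_update E x) S)"
    using fin by (simp add: edges_within_def)
  ultimately have "card (edges_within E S) \<le> card (insert e (edges_within (apply_update E x) S))"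
    by (intro card_mono) simp_all
  also have "\<dots> \<le> card (edges_within (apply_update E x) S) + 1"
    using card_insert_le_m1[of "card (edges_within (apply_update E x) S) + 1"] by (simp add: card_insert_if fin')
  finally show "real (card (edges_within E S)) \<le> real (card (edges_within (apply_update E x) S)) + 1"
    by (simp add: of_nat_le_iff[symmetric, where 'a = real] del: of_nat_le_iff)
qed (use assms in simp_all)

theorem theorem2:
  "\<exists>(A :: com \<times> com) (c :: real) (C :: real).
     \<forall>(n :: nat) (w :: nat). 2 \<le> n \<longrightarrow> c * log 2 (real n) \<le> real w \<longrightarrow>
       (\<forall>(E :: nat set set) (s :: state). reachable w A n E s \<longrightarrow>
          (let \<eta> = 1 / (2 * ln (real n)); \<rho> = max_density {..<n} E in
             \<exists>D. stores_orientation n s D \<and> orientation_of E D \<and>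
               (\<forall>(u, v) \<in> D. real (outdeg D u) \<le> (1 + \<eta>) * real (outdeg D v) + 2) \<and>
               real (max_outdeg {..<n} D) \<le> C * (\<rho> + ln (real n))) \<and>
          (\<forall>x. valid_update n E x \<longrightarrow>
             (let \<rho> = max_density {..<n} (apply_update E x) in
                \<exists>t s'. exec_update w A x s t s' \<and>
                  real t \<le> C * ((\<rho> + ln (real n)) * ln (real n) * max 1 (ln \<rho>)))))"
proof (rule exI[of _ "(insert_prog, delete_prog)"], rule exI[of _ "10 :: real"],
    rule exI[of _ "500000 :: real"], intro allI impI)
  fix n w :: nat and E s
  assume n: "2 \<le> n" and w: "10 * log 2 (real n) \<le> real w"
    and reach: "reachable w (insert_prog, delete_prog) n E s"
  have big: "big n w" using n w by (rule big_of_log)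
  obtain D where inv: "graph_inv n E D s" using graph_inv_reachable[OF reach big] by blast
  have D: "D \<subseteq> {..<n} \<times> {..<n}" and or: "orientation_of E D"
    using inv by (auto simp: graph_inv_def dest: rep_subset)
  define l where "l = ln (real n)"
  have l: "1 / 2 \<le> l" unfolding l_def by (rule half_le_ln[OF n])
  have finE: "finite E"
  proof -
    have "finite D" by (rule finite_subset[OF D]) simp
    with or show ?thesis unfolding orientation_of_def bij_betw_def by auto
  qed
  have deg: "real (outdeg D u) \<le> 4 * max_density {..<n} E + 16 * l" if "u < n" for u
    unfolding l_def by (rule graph_inv_outdeg_bound[OF n inv that])
  have "max_outdeg {..<n} D \<in> outdeg D ` {..<n}"
    unfolding max_outdeg_def using n by (intro Max_in) (auto simp: lessThan_empty_iff)
  then have "real (max_outdeg {..<n} D) \<le> 4 * max_density {..<n} E + 16 * l"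
    using deg by auto
  also have "\<dots> \<le> 500000 * (max_density {..<n} E + l)"
    using l max_density_nonneg[of n E] n by simp
  finally have max: "real (max_outdeg {..<n} D) \<le> 500000 * (max_density {..<n} E + ln (real n))"
    unfolding l_def .
  have time: "\<exists>t s'. exec_update w (insert_prog, delete_prog) x s t s' \<and>
      real t \<le> 500000 * ((\<rho> + ln (real n)) * ln (real n) * max 1 (ln \<rho>))"
    if x: "valid_update n E x" and \<rho>: "\<rho> = max_density {..<n} (apply_update E x)" for x \<rho>
  proof -
    \<comment> \<open>The degree bound before the update, rounded to the natural number that the
      timing of the programs takes as parameter.\<close>
    define N where "N = nat \<lfloor>4 * max_density {..<n} E + 16 * l\<rfloor>"
    have N0: "0 \<le> 4 * max_density {..<n} E + 16 * l"
      using l max_density_nonneg[of n E] n by simp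
    have "outdeg D y \<le> N" for y
    proof (cases "y < n")
      case True
      then show ?thesis using deg[OF True] unfolding N_def by (simp add: le_nat_floor)
    next
      case False
      then have "{v. (y, v) \<in> D} = {}" using D by auto
      then show ?thesis by (simp add: outdeg_def)
    qed
    then obtain t s' where t: "exec_update w (insert_prog, delete_prog) x s t s'"
      "t \<le> 3000 * (bits n * (N + 1))"
      using graph_inv_update[OF big inv x] by blast
    have \<rho>0: "0 \<le> \<rho>" unfolding \<rho> using n by (intro max_density_nonneg) simp
    have "real N \<le> 4 * max_density {..<n} E + 16 * l"
      unfolding N_def using N0 by simp
    also have "\<dots> \<le> 4 * (\<rho> + 1) + 16 * l"
      using max_density_update[OF n finE, of x] unfolding \<rho> by simp
    \<comment> \<open>Additive constants are absorbed by \<open>1 \<le> 2 * l\<close>: here 5 by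
      \<open>10 * l\<close>, and next the 1 in \<open>bits n\<close> by \<open>2 * l\<close>. The
      product 3000 * 6 * 26 = 468000 then explains the size of the final constant.\<close>
    finally have N1: "real N + 1 \<le> 26 * (\<rho> + l)" using l \<rho>0 by simp
    have b: "real (bits n) \<le> 6 * l"
      using lg_le_ln[OF n] l unfolding bits_def l_def by simp
    have "real t \<le> real (3000 * (bits n * (N + 1)))" using t(2) by (simp only: of_nat_le_iff)
    also have "\<dots> = 3000 * (real (bits n) * (real N + 1))" by simp
    also have "\<dots> \<le> 3000 * ((6 * l) * (26 * (\<rho> + l)))"
      using b N1 l by (intro mult_left_mono mult_mono) simp_all
    also have "\<dots> = 468000 * ((\<rho> + l) * l)" by simp
    also have "\<dots> \<le> 500000 * ((\<rho> + l) * l * max 1 (ln \<rho>))"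
    proof (rule mult_mono)
      have "0 \<le> (\<rho> + l) * l" using l \<rho>0 by simp
      then show "(\<rho> + l) * l \<le> (\<rho> + l) * l * max 1 (ln \<rho>)" "0 \<le> (\<rho> + l) * l"
        using mult_left_mono[of 1 "max 1 (ln \<rho>)" "(\<rho> + l) * l"] by simp_all
    qed simp_all
    finally show ?thesis using t(1) unfolding l_def by blast
  qed
  show "(let \<eta> = 1 / (2 * ln (real n)); \<rho> = max_density {..<n} E in
             \<exists>D. stores_orientation n s D \<and> orientation_of E D \<and>
               (\<forall>(u, v) \<in> D. real (outdeg D u) \<le> (1 + \<eta>) * real (outdeg D v) + 2) \<and>
               real (max_outdeg {..<n} D) \<le> 500000 * (\<rho> + ln (real n))) \<and>
          (\<forall>x. valid_update n E x \<longrightarrow>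
             (let \<rho> = max_density {..<n} (apply_update E x) in
                \<exists>t s'. exec_update w (insert_prog, delete_prog) x s t s' \<and>
                  real t \<le> 500000 * ((\<rho> + ln (real n)) * ln (real n) * max 1 (ln \<rho>))))"
    unfolding Let_def
    using graph_inv_stores[OF inv] or graph_inv_arc[OF n inv] max time by blast
qed

end
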